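(* Let $\mathcal{G}$ be a class of graphs defined by two forbidden induced subgraphs. Then $\mathcal{G}$ is not equivalent to any class of $(H_1,H_2)$-free graphs satisfying one of the conditions listed below if and only if $\mathcal{G}$ is equivalent to one of the following six classes: $(K_3,P_7)$-free, $(K_3,S_{1,2,3})$-free, $(K_4,S_{1,1,3})$-free, $(\mathrm{diamond},P_1+P_2+P_3)$-free, $(\mathrm{diamond},P_1+P_5)$-free, or $(\mathrm{gem},P_2+P_3)$-free graphs. The listed conditions are: (a) $H_1$ or $H_2 \subseteq_i P_4$; (b) $\overline{H_1}$ and $H_2 \subseteq_i K_{1,t}+P_1$ for some $t\geq 1$; (c) $\overline{H_1}$ and $H_2 \subseteq_i tP_1+P_3$ for some $t\geq 1$; (d) $H_1 \subseteq_i K_t$ and $H_2 \subseteq_i 2K_{1,t}$, $K_{1,t}^+$ or $P_5$ for some $t\geq 1$; (e) $H_1 \subseteq_i \mathrm{paw}$ and $H_2 \subseteq_i P_2+P_4$, $P_6$, $S_{1,2,2}$ or $K_{1,t}^{++}+P_1$ for some $t\geq 1$; (f) $H_1 \subseteq_i \mathrm{diamond}$ and $H_2 \subseteq_i P_1+2P_2$; (g) $H_1 \subseteq_i \mathrm{gem}$ and $H_2 \subseteq_i P_1+P_4$ or $P_5$; (h) $H_1 \subseteq_i \overline{2P_1+P_3}$ and $H_2 \subseteq_i P_2+P_3$ or $P_5$; (i) neither $H_1$ nor $H_2$ is a path star forest; (j) neither $\overline{H_1}$ nor $\overline{H_2}$ is a path star forest; (k) $H_1 \supseteq_i K_3$ and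 $H_2 \supseteq_i 2P_1+2P_2$, $P_1+2P_3$, $2P_1+P_4$ or $3P_2$; (l) $H_1 \supseteq_i K_4$ and $H_2 \supseteq_i K_{1,4}^{++}$, $P_1+2P_2$ or $P_1+P_4$; (m) $H_1 \supseteq_i K_5$ and $H_2 \supseteq_i K_{1,3}^{++}$; (n) $H_1 \supseteq_i C_4$ and $H_2 \supseteq_i K_{1,3}$, $3P_1+P_2$ or $2P_2$; (o) $H_1 \supseteq_i \mathrm{diamond}$ and $H_2 \supseteq_i K_{1,3}$, $P_2+P_4$, $2P_3$ or $P_6$; (p) $H_1 \supseteq_i \mathrm{gem}$ and $H_2 \supseteq_i P_1+2P_2$.
   Context: Conditions (a)–(h) are those under which Graph Isomorphism is known to be polynomial-time solvable on $(H_1,H_2)$-free graphs, and (i)–(p) those under which it is known to be GI-complete; the six listed classes are exactly the remaining open cases. A graph is $(H_1,H_2)$-free if it contains no induced subgraph isomorphic to $H_1$ or $H_2$; $F\subseteq_i G$ means $F$ is an induced subgraph of $G$. Given four graphs $H_1,H_2,H_3,H_4$, the classes of $(H_1,H_2)$-free graphs and $(H_3,H_4)$-free graphs are equivalent if the unordered pair $H_3,H_4$ can be obtained from the unordered pair $H_1,H_2$ by some combination of: (i) complementing both graphs in the pair, and (ii) if one of the graphs in the pair is $K_3$, replacing it with the paw or vice versa. Notation: $C_t,K_t,K_{1,t},P_r$ are the cycle, complete graph, star and path; $G+H$ is disjoint union, $tG$ is $t$ disjoint copies of $G$, $\overline{G}$ is the complement. $K_{1,t}^+$ and $K_{1,t}^{++}$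 are obtained from $K_{1,t}$ by subdividing one edge once or twice, respectively. The paw is $\overline{P_1+P_3}$, the diamond is $\overline{2P_1+P_2}$, the gem is $\overline{P_1+P_4}$. $S_{h,i,j}$ ($1\le h\le i\le j$) is the tree with exactly one vertex $x$ of degree 3 and exactly three leaves, at distances $h,i,j$ from $x$. A path star forest is a graph all of whose components are subdivided stars (stars with edges subdivided arbitrarily many times). *)

theory Defs
  imports Main
begin

text \<open>A finite simple graph on the vertex set {0..<n}: a pair (n, adj).
  Only the values of adj on {0..<n} are meaningful.\<close>
type_synonym graph = "nat \<times> (nat \<Rightarrow> nat \<Rightarrow> bool)"

definition wf_graph :: "graph \<Rightarrow> bool" where
  "wf_graph G \<longleftrightarrow> (\<forall>u<fst G. \<forall>v<fst G. snd G u v = snd G v u) \<and> (\<forall>u<fst G. \<not> snd G u u)"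

definition induced_sub :: "graph \<Rightarrow> graph \<Rightarrow> bool" where
  "induced_sub F G \<longleftrightarrow> (\<exists>f. inj_on f {..<fst F} \<and> f ` {..<fst F} \<subseteq> {..<fst G} \<and>
      (\<forall>u<fst F. \<forall>v<fst F. snd F u v \<longleftrightarrow> snd G (f u) (f v)))"

definition graph_iso :: "graph \<Rightarrow> graph \<Rightarrow> bool" where
  "graph_iso F G \<longleftrightarrow> (\<exists>f. bij_betw f {..<fst F} {..<fst G} \<and>
      (\<forall>u<fst F. \<forall>v<fst F. snd F u v \<longleftrightarrow> snd G (f u) (f v)))"

definition gcompl :: "graph \<Rightarrow> graph" where
  "gcompl G = (fst G, \<lambda>u v. u \<noteq> v \<and> \<not> snd G u v)"

definition gunion :: "graph \<Rightarrow> graph \<Rightarrow> graph" where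
  "gunion G H = (fst G + fst H, \<lambda>u v. (u < fst G \<and> v < fst G \<and> snd G u v) \<or>
      (fst G \<le> u \<and> fst G \<le> v \<and> snd H (u - fst G) (v - fst G)))"

definition null_graph :: graph where
  "null_graph = (0, \<lambda>_ _. False)"

fun gcopies :: "nat \<Rightarrow> graph \<Rightarrow> graph" where
  "gcopies 0 G = null_graph"
| "gcopies (Suc t) G = gunion G (gcopies t G)"

definition path_graph :: "nat \<Rightarrow> graph" where
  "path_graph r = (r, \<lambda>u v. u + 1 = v \<or> v + 1 = u)"

definition complete_graph :: "nat \<Rightarrow> graph" where
  "complete_graph t = (t, \<lambda>u v. u \<noteq> v)"

definition cycle_graph :: "nat \<Rightarrow> graph" where     (* C_t, t >= 3 *)
  "cycle_graph t = (t, \<lambda>u v. u + 1 = v \<or> v + 1 = u \<or> (u = 0 \<and> v + 1 = t) \<or> (v = 0 \<and> u + 1 = t))"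

definition star_graph :: "nat \<Rightarrow> graph" where
  "star_graph t = (Suc t, \<lambda>u v. (u = 0 \<and> v \<noteq> 0) \<or> (v = 0 \<and> u \<noteq> 0))"

text \<open>Subdivided star: centre 0 with legs (paths) of the given lengths attached.
  A leg of length l consists of l new vertices; legs of length 0 add nothing.\<close>
definition leg_edge :: "nat \<Rightarrow> nat \<Rightarrow> nat \<Rightarrow> nat \<Rightarrow> bool" where
  "leg_edge n l u v \<longleftrightarrow> (u = 0 \<and> v = n) \<or> (n \<le> u \<and> u + 1 = v \<and> v < n + l)"

fun spider :: "nat list \<Rightarrow> graph" where
  "spider [] = (1, \<lambda>_ _. False)"
| "spider (l # ls) = (let G = spider ls; n = fst G in
      if l = 0 then G else (n + l, \<lambda>u v. snd G u v \<or> leg_edge n l u v \<or> leg_edge n l v u))"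

text \<open>K_{1,t}^+ and K_{1,t}^{++}: K_{1,t} with one edge subdivided once / twice,
  i.e. one leg of length 2 / 3 and t-1 legs of length 1.\<close>
definition star_plus :: "nat \<Rightarrow> graph" where
  "star_plus t = spider (2 # replicate (t - 1) 1)"

definition star_pplus :: "nat \<Rightarrow> graph" where
  "star_pplus t = spider (3 # replicate (t - 1) 1)"

definition S_graph :: "nat \<Rightarrow> nat \<Rightarrow> nat \<Rightarrow> graph" where
  "S_graph h i j = spider [h, i, j]"

definition paw :: graph where
  "paw = gcompl (gunion (path_graph 1) (path_graph 3))"

definition diamond :: graph where
  "diamond = gcompl (gunion (gcopies 2 (path_graph 1)) (path_graph 2))"

definition gem :: graph where
  "gem = gcompl (gunion (path_graph 1) (path_graph 4))"

definition path_star_forest :: "graph \<Rightarrow> bool" where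
  "path_star_forest G \<longleftrightarrow> (\<exists>lss. (\<forall>ls\<in>set lss. \<forall>l\<in>set ls. 0 < l) \<and>
      graph_iso G (foldr gunion (map spider lss) null_graph))"

text \<open>One step of the equivalence on unordered pairs (pairs are ordered here,
  swapping is a step): complement both, replace K3 by paw or vice versa,
  and replacement by isomorphic graphs.\<close>
inductive equiv_step :: "graph \<times> graph \<Rightarrow> graph \<times> graph \<Rightarrow> bool" where
  swap: "equiv_step (A, B) (B, A)"
| compl: "equiv_step (A, B) (gcompl A, gcompl B)"
| iso: "graph_iso A A' \<Longrightarrow> graph_iso B B' \<Longrightarrow> equiv_step (A, B) (A', B')"
| k3_paw: "graph_iso A (complete_graph 3) \<Longrightarrow> graph_iso A' paw \<Longrightarrow> equiv_step (A, B) (A', B)"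
| paw_k3: "graph_iso A paw \<Longrightarrow> graph_iso A' (complete_graph 3) \<Longrightarrow> equiv_step (A, B) (A', B)"

definition pair_equiv :: "graph \<times> graph \<Rightarrow> graph \<times> graph \<Rightarrow> bool" where
  "pair_equiv = equiv_step\<^sup>*\<^sup>*"

abbreviation P :: "nat \<Rightarrow> graph" where "P \<equiv> path_graph"
abbreviation K :: "nat \<Rightarrow> graph" where "K \<equiv> complete_graph"
abbreviation plus :: "graph \<Rightarrow> graph \<Rightarrow> graph" (infixl "\<oplus>" 65) where "plus \<equiv> gunion"

definition known_condition :: "graph \<Rightarrow> graph \<Rightarrow> bool" where
  "known_condition H1 H2 \<longleftrightarrow>
   \<comment> \<open>(a)\<close> (induced_sub H1 (P 4) \<or> induced_sub H2 (P 4))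
 \<or> \<comment> \<open>(b)\<close> (\<exists>t\<ge>1. induced_sub (gcompl H1) (star_graph t \<oplus> P 1) \<and> induced_sub H2 (star_graph t \<oplus> P 1))
 \<or> \<comment> \<open>(c)\<close> (\<exists>t\<ge>1. induced_sub (gcompl H1) (gcopies t (P 1) \<oplus> P 3) \<and> induced_sub H2 (gcopies t (P 1) \<oplus> P 3))
 \<or> \<comment> \<open>(d)\<close> (\<exists>t\<ge>1. induced_sub H1 (K t) \<and>
        (induced_sub H2 (gcopies 2 (star_graph t)) \<or> induced_sub H2 (star_plus t) \<or> induced_sub H2 (P 5)))
 \<or> \<comment> \<open>(e)\<close> (induced_sub H1 paw \<and>
        (induced_sub H2 (P 2 \<oplus> P 4) \<or> induced_sub H2 (P 6) \<or> induced_sub H2 (S_graph 1 2 2) \<or>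
         (\<exists>t\<ge>1. induced_sub H2 (star_pplus t \<oplus> P 1))))
 \<or> \<comment> \<open>(f)\<close> (induced_sub H1 diamond \<and> induced_sub H2 (P 1 \<oplus> gcopies 2 (P 2)))
 \<or> \<comment> \<open>(g)\<close> (induced_sub H1 gem \<and> (induced_sub H2 (P 1 \<oplus> P 4) \<or> induced_sub H2 (P 5)))
 \<or> \<comment> \<open>(h)\<close> (induced_sub H1 (gcompl (gcopies 2 (P 1) \<oplus> P 3)) \<and>
        (induced_sub H2 (P 2 \<oplus> P 3) \<or> induced_sub H2 (P 5)))
 \<or> \<comment> \<open>(i)\<close> (\<not> path_star_forest H1 \<and> \<not> path_star_forest H2)
 \<or> \<comment> \<open>(j)\<close> (\<not> path_star_forest (gcompl H1) \<and> \<not> path_star_forest (gcompl H2))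
 \<or> \<comment> \<open>(k)\<close> (induced_sub (K 3) H1 \<and>
        (induced_sub (gcopies 2 (P 1) \<oplus> gcopies 2 (P 2)) H2 \<or> induced_sub (P 1 \<oplus> gcopies 2 (P 3)) H2 \<or>
         induced_sub (gcopies 2 (P 1) \<oplus> P 4) H2 \<or> induced_sub (gcopies 3 (P 2)) H2))
 \<or> \<comment> \<open>(l)\<close> (induced_sub (K 4) H1 \<and>
        (induced_sub (star_pplus 4) H2 \<or> induced_sub (P 1 \<oplus> gcopies 2 (P 2)) H2 \<or> induced_sub (P 1 \<oplus> P 4) H2))
 \<or> \<comment> \<open>(m)\<close> (induced_sub (K 5) H1 \<and> induced_sub (star_pplus 3) H2)
 \<or> \<comment> \<open>(n)\<close> (induced_sub (cycle_graph 4) H1 \<and>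
        (induced_sub (star_graph 3) H2 \<or> induced_sub (gcopies 3 (P 1) \<oplus> P 2) H2 \<or> induced_sub (gcopies 2 (P 2)) H2))
 \<or> \<comment> \<open>(o)\<close> (induced_sub diamond H1 \<and>
        (induced_sub (star_graph 3) H2 \<or> induced_sub (P 2 \<oplus> P 4) H2 \<or> induced_sub (gcopies 2 (P 3)) H2 \<or>
         induced_sub (P 6) H2))
 \<or> \<comment> \<open>(p)\<close> (induced_sub gem H1 \<and> induced_sub (P 1 \<oplus> gcopies 2 (P 2)) H2)"

end

theory Submission
  imports Defs "HOL-Library.Multiset"
begin

text \<open>
By (i) and (j), unless a graph and its complement are both path star forests (then it is an induced
subgraph of \<open>P\<^sub>4\<close>), an unresolved pair has, up to equivalence, the form \<open>(co-A, B)\<close> with \<open>A\<close> and \<open>B\<close>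
path star forests, and (a)-(h), (k)-(p) become conditions on the small induced subgraphs and the
supergraphs of \<open>A\<close> and \<open>B\<close>. Every path star forest that is not an induced subgraph of \<open>P\<^sub>4\<close> and is not
\<open>P\<^sub>1 + P\<^sub>3\<close> (which is interchangeable with \<open>3P\<^sub>1\<close>, the complement of the triangle) falls under one of
finitely many profiles, each a short list of such containments, and the profiles are compared pairwise.
Conversely, up to isomorphism the equivalence class of each of the six pairs is a finite set
that is searched exhaustively; the infinite families in (b)-(e) are replaced there by decidable
necessary conditions on vertex covers.
\<close>

section \<open>Induced subgraphs of disjoint unions and of spiders\<close>

text \<open>The four graphs of (k), that is 2P_1+2P_2, P_1+2P_3, 2P_1+P_4 and 3P_2, are absorbing: a
  path star forest containing one of them is resolved against every partner that is not an induced
  subgraph of P_4. Such a partner contains 3P_1, where (k) applies, or 2P_2, where (n) applies, as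
  each of the four contains 2P_2 or 3P_1+P_2. The forests avoiding all four are single small graphs
  or members of families that grow only by leaves of stars or by isolated vertices, and these
  families are covered by (b)-(e). This is what makes finitely many profiles possible. In the
  converse direction (i) and (j) are not executable as stated. They are refuted without search,
  because each of the six pairs consists of a path star forest and the complement of one.\<close>

definition forest :: "nat list list \<Rightarrow> graph" where
  "forest lss = foldr gunion (map spider lss) null_graph"

lemma forest_Nil: "forest [] = null_graph"
  by (simp add: forest_def)

lemma forest_Cons: "forest (x # xs) = gunion (spider x) (forest xs)"
  by (simp add: forest_def)

section \<open>Containment and isomorphism\<close>

lemma induced_sub_refl [simp]: "induced_sub G G"
  unfolding induced_sub_def by (rule exI[of _ id]) auto

lemma induced_sub_trans [trans]:
  assumes "induced_sub F G" "induced_sub G H" shows "induced_sub F H"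
proof -
  obtain f where f: "inj_on f {..<fst F}" "f ` {..<fst F} \<subseteq> {..<fst G}"
    "\<forall>u<fst F. \<forall>v<fst F. snd F u v \<longleftrightarrow> snd G (f u) (f v)" using assms(1) unfolding induced_sub_def by blast
  obtain g where g: "inj_on g {..<fst G}" "g ` {..<fst G} \<subseteq> {..<fst H}"
    "\<forall>u<fst G. \<forall>v<fst G. snd G u v \<longleftrightarrow> snd H (g u) (g v)" using assms(2) unfolding induced_sub_def by blast
  have "inj_on (g \<circ> f) {..<fst F}"
    using f(1,2) g(1) by (meson comp_inj_on inj_on_subset)
  moreover have "f u < fst G" if "u < fst F" for u using f(2) that by blast
  ultimately show ?thesis unfolding induced_sub_def
    using f(3) g(2,3) by (intro exI[of _ "g \<circ> f"]) (auto simp: image_subset_iff)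
qed

lemma graph_iso_imp_induced_sub: "graph_iso F G \<Longrightarrow> induced_sub F G"
  unfolding graph_iso_def induced_sub_def bij_betw_def by auto

lemma graph_iso_refl [simp]: "graph_iso G G"
  unfolding graph_iso_def by (rule exI[of _ id]) auto

lemma graph_iso_sym: assumes "graph_iso F G" shows "graph_iso G F"
proof -
  obtain f where f: "bij_betw f {..<fst F} {..<fst G}"
    "\<forall>u<fst F. \<forall>v<fst F. snd F u v \<longleftrightarrow> snd G (f u) (f v)" using assms unfolding graph_iso_def by blast
  let ?g = "inv_into {..<fst F} f"
  have g: "bij_betw ?g {..<fst G} {..<fst F}" using f(1) by (rule bij_betw_inv_into)
  have 1: "?g u < fst F" if "u < fst G" for u
    using that bij_betwE[OF g] by auto
  have "f (?g u) = u" if "u < fst G" for u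
    using that f(1) by (auto simp: bij_betw_inv_into_right)
  with 1 show ?thesis unfolding graph_iso_def using f(2) g by (intro exI[of _ ?g]) auto
qed

lemma graph_iso_trans [trans]: assumes "graph_iso F G" "graph_iso G H" shows "graph_iso F H"
proof -
  obtain f where f: "bij_betw f {..<fst F} {..<fst G}"
    "\<forall>u<fst F. \<forall>v<fst F. snd F u v \<longleftrightarrow> snd G (f u) (f v)" using assms unfolding graph_iso_def by blast
  obtain g where g: "bij_betw g {..<fst G} {..<fst H}"
    "\<forall>u<fst G. \<forall>v<fst G. snd G u v \<longleftrightarrow> snd H (g u) (g v)" using assms unfolding graph_iso_def by blast
  have "f u < fst G" if "u < fst F" for u using f(1) that by (auto simp: bij_betw_def)
  then show ?thesis unfolding graph_iso_def using f g
    by (intro exI[of _ "g \<circ> f"]) (auto intro: bij_betw_trans)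
qed

lemma graph_iso_fst: "graph_iso F G \<Longrightarrow> fst F = fst G"
  unfolding graph_iso_def using bij_betw_same_card by fastforce

lemma induced_sub_fst: "induced_sub F G \<Longrightarrow> fst F \<le> fst G"
  unfolding induced_sub_def by (metis card_lessThan card_mono card_image finite_lessThan)

text \<open>An injection into a finite set that is no larger is onto. Comparing orders thus upgrades
  a containment to an isomorphism, which is how isomorphism is decided later.\<close>

lemma induced_sub_same_size: assumes "induced_sub F G" "fst G \<le> fst F" shows "graph_iso F G"
proof -
  obtain f where f: "inj_on f {..<fst F}" "f ` {..<fst F} \<subseteq> {..<fst G}"
    "\<forall>u<fst F. \<forall>v<fst F. snd F u v \<longleftrightarrow> snd G (f u) (f v)" using assms(1) unfolding induced_sub_def by blast
  have "f ` {..<fst F} = {..<fst G}"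
    by (rule card_seteq) (use f assms in \<open>auto simp: card_image\<close>)
  with f show ?thesis unfolding graph_iso_def bij_betw_def by blast
qed

lemma graph_iso_id:
  assumes "fst F = fst G" "\<And>u v. u < fst G \<Longrightarrow> v < fst G \<Longrightarrow> snd F u v = snd G u v"
  shows "graph_iso F G"
  unfolding graph_iso_def using assms by (intro exI[of _ id]) auto

section \<open>Disjoint unions and permutations of components\<close>

lemma gunion_assoc: "gunion (gunion A B) C = gunion A (gunion B C)"
  by (auto simp: gunion_def fun_eq_iff)

lemma gunion_null_left [simp]: "gunion null_graph G = G"
  unfolding gunion_def null_graph_def by (cases G) auto

lemma forest_append: "forest (xs @ ys) = gunion (forest xs) (forest ys)"
  by (induction xs) (auto simp: gunion_assoc forest_Nil forest_Cons)

lemma gunion_mono: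
  assumes "induced_sub A A'" "induced_sub B B'" shows "induced_sub (gunion A B) (gunion A' B')"
proof -
  obtain f where f: "inj_on f {..<fst A}" "\<And>u. u < fst A \<Longrightarrow> f u < fst A'"
    "\<forall>u<fst A. \<forall>v<fst A. snd A u v \<longleftrightarrow> snd A' (f u) (f v)" using assms(1) unfolding induced_sub_def by blast
  obtain g where g: "inj_on g {..<fst B}" "\<And>u. u < fst B \<Longrightarrow> g u < fst B'"
    "\<forall>u<fst B. \<forall>v<fst B. snd B u v \<longleftrightarrow> snd B' (g u) (g v)" using assms(2) unfolding induced_sub_def by blast
  let ?h = "\<lambda>u. if u < fst A then f u else fst A' + g (u - fst A)"
  have "inj_on ?h {..<fst (gunion A B)}"
  proof (rule inj_onI)
    fix x y assume xy: "x \<in> {..<fst (gunion A B)}" "y \<in> {..<fst (gunion A B)}" "?h x = ?h y"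
    have l: "x < fst A + fst B" "y < fst A + fst B" using xy(1,2) by (auto simp: gunion_def)
    consider "x < fst A" "y < fst A" | "x \<ge> fst A" "y \<ge> fst A" | "x < fst A" "y \<ge> fst A" | "x \<ge> fst A" "y < fst A"
      by linarith
    then show "x = y"
    proof cases
      case 1 then show ?thesis using xy(3) f(1) by (auto simp: inj_on_def)
    next
      case 2
      then have "g (x - fst A) = g (y - fst A)" using xy(3) by simp
      then have "x - fst A = y - fst A" using g(1) l 2 by (auto simp: inj_on_def)
      then show ?thesis using 2 by linarith
    next
      case 3 then show ?thesis using xy(3) f(2)[of x] by simp
    next
      case 4 then show ?thesis using xy(3) f(2)[of y] by simp
    qed
  qed
  moreover have "?h ` {..<fst (gunion A B)} \<subseteq> {..<fst (gunion A' B')}"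
    using f(2) g(2) by (fastforce simp: gunion_def)
  moreover have "snd (gunion A B) u v \<longleftrightarrow> snd (gunion A' B') (?h u) (?h v)"
    if "u < fst (gunion A B)" "v < fst (gunion A B)" for u v
    using that f(2)[of u] f(2)[of v] f(3) g(3)
    by (auto simp: gunion_def)
  ultimately show ?thesis unfolding induced_sub_def by blast
qed

lemma gunion_comm_sub: "induced_sub (gunion A B) (gunion B A)"
  unfolding induced_sub_def
  by (intro exI[of _ "\<lambda>u. if u < fst A then fst B + u else u - fst A"]) (auto simp: gunion_def inj_on_def split: if_splits)

lemma null_sub [simp]: "induced_sub null_graph G"
  unfolding induced_sub_def null_graph_def by simp

text \<open>The hypothesis is symmetric, so this one containment amounts to an isomorphism. The head
  of \<open>xs\<close> is commuted past the prefix before its occurrence in \<open>ys\<close>;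
  rebracketing is free, since \<open>gunion_assoc\<close> is an equation.\<close>

lemma forest_perm: "mset xs = mset ys \<Longrightarrow> induced_sub (forest xs) (forest ys)"
proof (induction xs arbitrary: ys)
  case Nil then show ?case by (simp add: forest_Nil)
next
  case (Cons x xs)
  then have "x \<in> set ys" by (metis list.set_intros(1) mset_eq_setD)
  then obtain as bs where ys: "ys = as @ x # bs" by (meson split_list)
  have "mset xs = mset (as @ bs)" using Cons.prems by (simp add: ys)
  then have "induced_sub (forest xs) (forest (as @ bs))" by (rule Cons.IH)
  then have "induced_sub (forest (x # xs)) (gunion (spider x) (gunion (forest as) (forest bs)))"
    using gunion_mono[of "spider x" "spider x"] by (simp only: forest_Cons forest_append induced_sub_refl)
  also have "\<dots> = gunion (gunion (spider x) (forest as)) (forest bs)" by (simp add: gunion_assoc)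
  also have "induced_sub \<dots> (gunion (gunion (forest as) (spider x)) (forest bs))"
    by (intro gunion_mono gunion_comm_sub) simp
  also have "\<dots> = forest ys" by (simp add: ys forest_append gunion_assoc forest_Cons)
  finally show ?case .
qed

section \<open>Spiders and permutations of legs\<close>

lemma spider_pos: "0 < fst (spider ls)"
  by (induction ls) (auto simp: Let_def)

text \<open>\<open>spider\<close> joins the old adjacency to the new leg without restricting it to
  the old vertices. That is sound only because spiders have no stray adjacencies outside their
  vertex range.\<close>

lemma spider_adj_less: "snd (spider ls) u v \<Longrightarrow> u < fst (spider ls) \<and> v < fst (spider ls)"
  by (induction ls arbitrary: u v) (use spider_pos in \<open>fastforce simp: Let_def leg_edge_def split: if_splits\<close>)+

lemma spider_irrefl: "\<not> snd (spider ls) u u"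
proof (induction ls)
  case (Cons l ls)
  then show ?case using spider_pos[of ls] by (auto simp: Let_def leg_edge_def)
qed simp

lemma fst_spider: "fst (spider ls) = Suc (sum_list ls)"
  by (induction ls) (auto simp: Let_def)

text \<open>New legs are attached at vertex 0, so an embedding extends to a further leg only if it
  sends centre to centre. Inductions over legs run on this stronger relation and pass to
  \<open>induced_sub\<close> at the end.\<close>

definition rooted_sub :: "graph \<Rightarrow> graph \<Rightarrow> bool" where
  "rooted_sub F G \<longleftrightarrow> (\<exists>f. f 0 = 0 \<and> inj_on f {..<fst F} \<and> f ` {..<fst F} \<subseteq> {..<fst G} \<and>
      (\<forall>u<fst F. \<forall>v<fst F. snd F u v \<longleftrightarrow> snd G (f u) (f v)))"

lemma rooted_sub_imp_induced_sub: "rooted_sub F G \<Longrightarrow> induced_sub F G"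
  unfolding rooted_sub_def induced_sub_def by blast

lemma rooted_sub_refl [simp]: "rooted_sub G G"
  unfolding rooted_sub_def by (rule exI[of _ id]) auto

lemma rooted_sub_trans [trans]:
  assumes "rooted_sub F G" "rooted_sub G H" shows "rooted_sub F H"
proof -
  obtain f where f: "f 0 = 0" "inj_on f {..<fst F}" "f ` {..<fst F} \<subseteq> {..<fst G}"
    "\<forall>u<fst F. \<forall>v<fst F. snd F u v \<longleftrightarrow> snd G (f u) (f v)" using assms(1) unfolding rooted_sub_def by blast
  obtain g where g: "g 0 = 0" "inj_on g {..<fst G}" "g ` {..<fst G} \<subseteq> {..<fst H}"
    "\<forall>u<fst G. \<forall>v<fst G. snd G u v \<longleftrightarrow> snd H (g u) (g v)" using assms(2) unfolding rooted_sub_def by blast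
  have "inj_on (g \<circ> f) {..<fst F}"
    using f(2,3) g(2) by (meson comp_inj_on inj_on_subset)
  moreover have "f u < fst G" if "u < fst F" for u using f(3) that by blast
  ultimately show ?thesis unfolding rooted_sub_def
    using f(1,4) g(1,3,4) by (intro exI[of _ "g \<circ> f"]) (auto simp: image_subset_iff)
qed

lemma spider_Cons_adj:
  "snd (spider (l # ls)) u v \<longleftrightarrow> snd (spider ls) u v \<or>
     0 < l \<and> (leg_edge (fst (spider ls)) l u v \<or> leg_edge (fst (spider ls)) l v u)"
  by (simp add: Let_def)

text \<open>The shorter new leg is laid along the beginning of the longer one, next to the centre,
  by shifting its block of vertices.\<close>

lemma attach_mono:
  assumes "rooted_sub (spider as) (spider bs)" "l \<le> k"
  shows "rooted_sub (spider (l # as)) (spider (k # bs))"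
proof -
  define m n where "m = fst (spider as)" and "n = fst (spider bs)"
  have pos: "0 < m" "0 < n" by (simp_all add: m_def n_def spider_pos)
  obtain f where f: "f 0 = 0" "inj_on f {..<m}" "f ` {..<m} \<subseteq> {..<n}"
    "\<forall>u<m. \<forall>v<m. snd (spider as) u v \<longleftrightarrow> snd (spider bs) (f u) (f v)"
    using assms(1) unfolding rooted_sub_def m_def n_def by auto
  define h where "h u = (if u < m then f u else n + (u - m))" for u
  have h1: "u < m \<Longrightarrow> h u < n" and h2: "\<not> u < m \<Longrightarrow> h u = n + (u - m)" for u
    using f(3) by (auto simp: h_def)
  \<comment> \<open>Both directions matter: a leg may start only at the centre, so no other vertex
    may land on 0.\<close>
  have h0: "u = 0 \<longleftrightarrow> h u = 0" for u
  proof (cases "u < m")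
    case True
    then show ?thesis using inj_onD[OF f(2), of u 0] f(1) pos by (auto simp: h_def)
  next
    case False
    then show ?thesis using pos by (auto simp: h_def)
  qed
  have fst: "fst (spider (l # as)) = m + l" "fst (spider (k # bs)) = n + k"
    by (auto simp: m_def n_def Let_def)
  have "x = y" if "h x = h y" for x y
  proof (cases "x < m"; cases "y < m")
    assume "x < m" "y < m" then show ?thesis using that inj_onD[OF f(2), of x y] by (simp add: h_def)
  next
    assume "x < m" "\<not> y < m" then show ?thesis using that h1[of x] h2[of y] by linarith
  next
    assume "\<not> x < m" "y < m" then show ?thesis using that h1[of y] h2[of x] by linarith
  next
    assume "\<not> x < m" "\<not> y < m" then show ?thesis using that h2[of x] h2[of y] by linarith
  qed
  then have inj: "inj_on h {..<m + l}" by (simp add: inj_on_def)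
  have le: "h u < n + k" if "u < m + l" for u
    using h1[of u] h2[of u] that assms(2) by linarith
  have leg: "(0 < l \<and> leg_edge m l u v) \<longleftrightarrow> (0 < k \<and> leg_edge n k (h u) (h v))"
    if "u < m + l" "v < m + l" for u v
  proof -
    have "(0 < l \<and> v = m) \<longleftrightarrow> (0 < k \<and> h v = n)"
      using h1[of v] h2[of v] that assms(2) by (cases "v < m") auto
    moreover have "(0 < l \<and> m \<le> u \<and> u + 1 = v \<and> v < m + l) \<longleftrightarrow> (0 < k \<and> n \<le> h u \<and> h u + 1 = h v \<and> h v < n + k)"
      using h1[of u] h2[of u] h1[of v] h2[of v] that assms(2) by (cases "u < m"; cases "v < m") auto
    ultimately show ?thesis using h0[of u] by (simp only: leg_edge_def) argo
  qed
  have old: "snd (spider as) u v \<longleftrightarrow> snd (spider bs) (h u) (h v)" for u v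
  proof (cases "u < m \<and> v < m")
    case True then show ?thesis using f(4) by (simp add: h_def)
  next
    case False
    then have "\<not> snd (spider as) u v" using spider_adj_less[of as u v] by (auto simp: m_def)
    moreover have "\<not> h u < n \<or> \<not> h v < n" using False h2[of u] h2[of v] by linarith
    then have "\<not> snd (spider bs) (h u) (h v)" using spider_adj_less[of bs "h u" "h v"] by (auto simp: n_def)
    ultimately show ?thesis by simp
  qed
  have "snd (spider (l # as)) u v \<longleftrightarrow> snd (spider (k # bs)) (h u) (h v)"
    if "u < m + l" "v < m + l" for u v
    unfolding spider_Cons_adj m_def[symmetric] n_def[symmetric]
    using old[of u v] leg[of u v] leg[of v u] that by blast
  moreover have "h 0 = 0" using h0[of 0] by simp
  ultimately show ?thesis unfolding rooted_sub_def fst using inj le by blast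
qed

lemma attach_swap: "rooted_sub (spider (k # l # ls)) (spider (l # k # ls))"
proof (cases "k = 0 \<or> l = 0")
  case True then show ?thesis by (auto simp: Let_def)
next
  case False
  define n where "n = fst (spider ls)"
  have n: "0 < n" by (simp add: n_def spider_pos)
  \<comment> \<open>The head of the list is attached last. On the left the block of \<open>l\<close>
    vertices therefore precedes that of \<open>k\<close>, on the right it follows it; the map
    exchanges the two blocks.\<close>
  define h where "h u = (if u < n then u else if u < n + l then u + k else u - l)" for u
  have h: "u < n \<and> h u = u \<or> n \<le> u \<and> u < n + l \<and> h u = u + k \<or> n + l \<le> u \<and> h u = u - l" for u
    by (auto simp: h_def)
  have fst: "fst (spider (k # l # ls)) = n + l + k" "fst (spider (l # k # ls)) = n + l + k"
    "fst (spider (k # ls)) = n + k" "fst (spider (l # ls)) = n + l"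
    by (auto simp: n_def Let_def)
  have inj: "inj_on h {..<n + l + k}"
  proof (rule inj_onI)
    fix x y assume "x \<in> {..<n + l + k}" "y \<in> {..<n + l + k}" "h x = h y"
    then show "x = y" using h[of x] h[of y] by (simp only: lessThan_iff) linarith
  qed
  have le: "h u < n + l + k" if "u < n + l + k" for u using h[of u] that by linarith
  have "leg_edge n l u v \<longleftrightarrow> leg_edge (n + k) l (h u) (h v)" if "u < n + l + k" "v < n + l + k" for u v
    unfolding leg_edge_def using False h[of u] h[of v] n that by auto
  moreover have "leg_edge (n + l) k u v \<longleftrightarrow> leg_edge n k (h u) (h v)" if "u < n + l + k" "v < n + l + k" for u v
    unfolding leg_edge_def using False h[of u] h[of v] n that by auto
  moreover have "snd (spider ls) u v \<longleftrightarrow> snd (spider ls) (h u) (h v)" for u v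
  proof (cases "u < n \<and> v < n")
    case True then show ?thesis by (simp add: h_def)
  next
    case False
    then have "\<not> (h u < n \<and> h v < n)" using h[of u] h[of v] by linarith
    with False show ?thesis using spider_adj_less[of ls u v] spider_adj_less[of ls "h u" "h v"]
      by (auto simp: n_def)
  qed
  ultimately have "snd (spider (k # l # ls)) u v \<longleftrightarrow> snd (spider (l # k # ls)) (h u) (h v)"
    if "u < n + l + k" "v < n + l + k" for u v
    using that False unfolding spider_Cons_adj fst n_def[symmetric] by auto
  moreover have "h 0 = 0" using n by (simp add: h_def)
  ultimately show ?thesis unfolding rooted_sub_def fst using inj le by blast
qed

lemma spider_perm: "mset xs = mset ys \<Longrightarrow> rooted_sub (spider xs) (spider ys)"
proof (induction xs arbitrary: ys)
  case Nil then show ?case by simp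
next
  case (Cons x xs)
  then have "x \<in> set ys" by (metis list.set_intros(1) mset_eq_setD)
  then obtain as bs where ys: "ys = as @ x # bs" by (meson split_list)
  have "mset xs = mset (as @ bs)" using Cons.prems by (simp add: ys)
  then have "rooted_sub (spider xs) (spider (as @ bs))" by (rule Cons.IH)
  then have "rooted_sub (spider (x # xs)) (spider (x # as @ bs))" by (rule attach_mono) simp
  also have "rooted_sub \<dots> (spider (as @ x # bs))"
  proof (induction as)
    case (Cons a as)
    then have "rooted_sub (spider (a # x # as @ bs)) (spider (a # as @ x # bs))" by (rule attach_mono) simp
    with attach_swap show ?case unfolding append_Cons by (rule rooted_sub_trans)
  qed simp
  finally show ?case by (simp only: ys)
qed

text \<open>These orders compare position by position; missing legs and components are allowed only at the end of the
  smaller list, and \<open>[]\<close>, an isolated vertex, is below every component.\<close>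

fun legs_le :: "nat list \<Rightarrow> nat list \<Rightarrow> bool" where
  "legs_le [] bs = True"
| "legs_le (a # as) [] = False"
| "legs_le (a # as) (b # bs) = (a \<le> b \<and> legs_le as bs)"

fun forest_le :: "nat list list \<Rightarrow> nat list list \<Rightarrow> bool" where
  "forest_le [] ys = True"
| "forest_le (x # xs) [] = False"
| "forest_le (x # xs) (y # ys) = (legs_le x y \<and> forest_le xs ys)"

lemma legs_le_rooted_sub: "legs_le as bs \<Longrightarrow> rooted_sub (spider as) (spider bs)"
proof (induction as bs rule: legs_le.induct)
  case (1 bs)
  have "rooted_sub (spider []) (spider bs)" unfolding rooted_sub_def
    using spider_pos[of bs] spider_irrefl[of bs] by (intro exI[of _ id]) auto
  then show ?case .
next
  case (3 a as b bs)
  then show ?case by (intro attach_mono) auto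
qed simp

lemma forest_le_sub: "forest_le xs ys \<Longrightarrow> induced_sub (forest xs) (forest ys)"
proof (induction xs ys rule: forest_le.induct)
  case (3 x xs y ys)
  then show ?case unfolding forest_Cons
    by (intro gunion_mono) (auto intro: legs_le_rooted_sub rooted_sub_imp_induced_sub)
qed (auto simp: forest_Nil)

lemma spider_single_adj:
  "snd (spider [n]) u v \<longleftrightarrow> (u + 1 = v \<and> v \<le> n \<or> v + 1 = u \<and> u \<le> n)"
  by (auto simp: Let_def leg_edge_def)

lemma spider_two_legs:
  assumes "0 < a" "0 < b" shows "graph_iso (spider [a, b]) (spider [a + b])"
proof -
  \<comment> \<open>The leg of length \<open>b\<close> is reversed: its tip becomes the new root and
    the old centre moves to position \<open>b\<close>, where the vertices of the other leg already
    follow.\<close>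
  define h where "h u = (if u \<le> b then b - u else u)" for u
  have h: "u \<le> b \<and> h u + u = b \<or> b < u \<and> h u = u" for u by (auto simp: h_def)
  have fst: "fst (spider [a, b]) = Suc (a + b)" "fst (spider [b]) = Suc b" "fst (spider [a + b]) = Suc (a + b)"
    by (simp_all add: fst_spider del: spider.simps)
  have "inj_on h {..<Suc (a + b)}"
  proof (rule inj_onI)
    fix x y assume "h x = h y" then show "x = y" using h[of x] h[of y] by linarith
  qed
  moreover have "h u < Suc (a + b)" if "u < Suc (a + b)" for u using h[of u] that by linarith
  moreover have "snd (spider [a, b]) u v \<longleftrightarrow> snd (spider [a + b]) (h u) (h v)"
    if "u < Suc (a + b)" "v < Suc (a + b)" for u v
    unfolding spider_Cons_adj[of a] spider_single_adj fst leg_edge_def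
    using assms that by (cases "u \<le> b"; cases "v \<le> b") (auto simp: h_def)
  ultimately have "induced_sub (spider [a,b]) (spider [a+b])"
    unfolding induced_sub_def fst by blast
  then show ?thesis by (rule induced_sub_same_size) (simp add: fst_spider del: spider.simps)
qed

section \<open>Deciding containment of concrete graphs\<close>

text \<open>A complete backtracking search. Declared as a code equation below, it lets \<open>code_simp\<close> decide
  every concrete instance of \<^const>\<open>induced_sub\<close> and \<^const>\<open>graph_iso\<close>.\<close>

fun extend_embedding :: "graph \<Rightarrow> graph \<Rightarrow> nat list \<Rightarrow> nat \<Rightarrow> bool" where
  "extend_embedding F G xs 0 = True"
| "extend_embedding F G xs (Suc m) = list_ex (\<lambda>v. v \<notin> set xs \<and>
      list_all (\<lambda>(i, x). snd F i (length xs) = snd G x v \<and> snd F (length xs) i = snd G v x) (enumerate 0 xs) \<and>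
      snd F (length xs) (length xs) = snd G v v \<and>
      extend_embedding F G (xs @ [v]) m) [0..<fst G]"

text \<open>\<open>xs\<close> holds the images of the vertices below \<open>length xs\<close>, and
  \<open>m\<close> counts those still to be placed. The claim covers every valid partial embedding
  because the search extends one vertex at a time; the empty list gives the full problem.\<close>

lemma extend_embedding_iff:
  assumes "length xs + m = fst F" "distinct xs" "set xs \<subseteq> {..<fst G}"
    "\<forall>i<length xs. \<forall>j<length xs. snd F i j = snd G (xs ! i) (xs ! j)"
  shows "extend_embedding F G xs m \<longleftrightarrow> (\<exists>f. inj_on f {..<fst F} \<and> f ` {..<fst F} \<subseteq> {..<fst G} \<and>
      (\<forall>u<fst F. \<forall>v<fst F. snd F u v \<longleftrightarrow> snd G (f u) (f v)) \<and> (\<forall>i<length xs. f i = xs ! i))"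
  using assms
proof (induction m arbitrary: xs)
  case 0
  then show ?case
    by (auto intro!: exI[of _ "\<lambda>i. xs ! i"] simp: inj_on_def nth_eq_iff_index_eq
        dest: subsetD[OF _ nth_mem])
next
  case (Suc m)
  let ?n = "length xs"
  define E where "E f \<longleftrightarrow> inj_on f {..<fst F} \<and> f ` {..<fst F} \<subseteq> {..<fst G} \<and>
      (\<forall>u<fst F. \<forall>v<fst F. snd F u v \<longleftrightarrow> snd G (f u) (f v))" for f
  define ok where "ok v \<longleftrightarrow> v \<notin> set xs \<and>
      (\<forall>i<?n. snd F i ?n = snd G (xs ! i) v \<and> snd F ?n i = snd G v (xs ! i)) \<and> snd F ?n ?n = snd G v v" for v
  have step: "extend_embedding F G (xs @ [v]) m \<longleftrightarrow> (\<exists>f. E f \<and> (\<forall>i<Suc ?n. f i = (xs @ [v]) ! i))"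
    if "v < fst G" "ok v" for v
    using that Suc.prems by (subst Suc.IH) (auto simp: nth_append less_Suc_eq ok_def E_def)
  have "extend_embedding F G xs (Suc m) \<longleftrightarrow> (\<exists>v<fst G. ok v \<and> extend_embedding F G (xs @ [v]) m)"
    by (simp add: list_ex_iff list_all_length nth_enumerate_eq Bex_def conj_assoc ok_def)
  also have "\<dots> \<longleftrightarrow> (\<exists>f. E f \<and> (\<forall>i<?n. f i = xs ! i))"
  proof
    assume "\<exists>v<fst G. ok v \<and> extend_embedding F G (xs @ [v]) m"
    then obtain v f where f: "E f" "\<forall>i<Suc ?n. f i = (xs @ [v]) ! i" using step by blast
    have "f i = xs ! i" if "i < ?n" for i using f(2)[rule_format, of i] that by (simp add: nth_append)
    then show "\<exists>f. E f \<and> (\<forall>i<?n. f i = xs ! i)" using f(1) by blast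
  next
    assume "\<exists>f. E f \<and> (\<forall>i<?n. f i = xs ! i)"
    then obtain f where f: "E f" "\<forall>i<?n. f i = xs ! i" by blast
    have n: "?n < fst F" using Suc.prems(1) by simp
    have inj: "inj_on f {..<fst F}" and img: "f ` {..<fst F} \<subseteq> {..<fst G}"
      and adj: "\<And>u v. u < fst F \<Longrightarrow> v < fst F \<Longrightarrow> snd F u v \<longleftrightarrow> snd G (f u) (f v)"
      using f(1) by (auto simp: E_def)
    have "f ?n \<notin> set xs"
    proof
      assume "f ?n \<in> set xs"
      then obtain i where i: "i < ?n" "f ?n = f i" using f(2) by (auto simp: in_set_conv_nth)
      then have "?n = i" using inj n by (auto simp: inj_on_def)
      then show False using i(1) by simp
    qed
    moreover have "snd F i ?n = snd G (xs ! i) (f ?n) \<and> snd F ?n i = snd G (f ?n) (xs ! i)" if "i < ?n" for i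
      using adj[of i ?n] adj[of ?n i] f(2) n that by simp
    ultimately have "ok (f ?n)" using adj[OF n n] by (simp add: ok_def)
    moreover have "f ?n < fst G" using img n by blast
    moreover have "\<forall>i<Suc ?n. f i = (xs @ [f ?n]) ! i" using f(2) by (auto simp: nth_append less_Suc_eq)
    ultimately show "\<exists>v<fst G. ok v \<and> extend_embedding F G (xs @ [v]) m"
      using f(1) step by blast
  qed
  finally show ?case by (simp add: E_def conj_assoc)
qed

lemma induced_sub_code [code]: "induced_sub F G \<longleftrightarrow> fst F \<le> fst G \<and> extend_embedding F G [] (fst F)"
proof -
  have "induced_sub F G \<longleftrightarrow> extend_embedding F G [] (fst F)"
    unfolding induced_sub_def by (subst extend_embedding_iff) auto
  then show ?thesis using induced_sub_fst by blast
qed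

lemma forest_code [code]: "forest [] = null_graph" "forest (x # xs) = gunion (spider x) (forest xs)"
  by (simp_all add: forest_Nil forest_Cons)

abbreviation induced_sub_infix :: "graph \<Rightarrow> graph \<Rightarrow> bool" (infix "\<sqsubseteq>" 50) where
  "F \<sqsubseteq> G \<equiv> induced_sub F G"

lemma graph_iso_code [code]: "graph_iso F G \<longleftrightarrow> fst F = fst G \<and> F \<sqsubseteq> G"
  by (metis graph_iso_fst graph_iso_imp_induced_sub induced_sub_same_size order_refl)

lemma graph_iso_iff_mutual: "graph_iso F G \<longleftrightarrow> F \<sqsubseteq> G \<and> G \<sqsubseteq> F"
  by (meson graph_iso_imp_induced_sub graph_iso_sym induced_sub_fst induced_sub_same_size)

text \<open>The three rules match the three kinds of premises in a profile: isomorphism, lower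
  containment and upper containment. A single \<open>erule\<close> thus moves each premise from
  \<open>G\<close> to a concrete graph, where it is evaluated.\<close>

lemma iso_transfer:
  "graph_iso G H \<Longrightarrow> graph_iso H X \<Longrightarrow> graph_iso G X"
  "graph_iso G H \<Longrightarrow> F \<sqsubseteq> H \<Longrightarrow> F \<sqsubseteq> G"
  "graph_iso G H \<Longrightarrow> H \<sqsubseteq> F \<Longrightarrow> G \<sqsubseteq> F"
  by (auto simp: graph_iso_iff_mutual intro: induced_sub_trans)

section \<open>Profiles of path star forests\<close>

text \<open>Asking for all large \<open>t\<close>, not just one, provides a common \<open>t\<close> for the two graphs of a pair.\<close>

definition fits :: "(nat \<Rightarrow> graph) \<Rightarrow> graph \<Rightarrow> bool" where
  "fits H G \<longleftrightarrow> (\<exists>n. \<forall>t\<ge>n. G \<sqsubseteq> H t)"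

lemma legs_le_refl [simp]: "legs_le xs xs"
  by (induction xs) auto

lemma legs_le_replicate [simp]: "legs_le (replicate k (Suc 0)) (replicate t (Suc 0)) \<longleftrightarrow> k \<le> t"
proof (induction k arbitrary: t)
  case (Suc k) then show ?case by (cases t) auto
qed simp

lemma forest_le_refl [simp]: "forest_le xs xs"
  by (induction xs) auto

lemma forest_le_isolated [simp]: "forest_le (replicate k []) ys \<longleftrightarrow> k \<le> length ys"
proof (induction k arbitrary: ys)
  case (Suc k) then show ?case by (cases ys) auto
qed simp

lemma spider_star_adj: "snd (spider (replicate t (Suc 0))) u v \<longleftrightarrow> u \<le> t \<and> v \<le> t \<and> (u = 0 \<and> v \<noteq> 0 \<or> v = 0 \<and> u \<noteq> 0)"
proof (induction t)
  case (Suc t)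
  then show ?case
    by (auto simp: spider_Cons_adj leg_edge_def fst_spider sum_list_replicate simp del: spider.simps)
qed auto

lemma spider_star: "graph_iso (spider (replicate t (Suc 0))) (star_graph t)"
  by (rule graph_iso_id) (auto simp: spider_star_adj fst_spider sum_list_replicate star_graph_def)

lemma forest_single: "graph_iso (forest [c]) (spider c)"
  by (rule graph_iso_id) (auto simp: forest_Cons forest_Nil gunion_def null_graph_def)

lemma gcopies_eq_forest: "gcopies t (spider c) = forest (replicate t c)"
  by (induction t) (auto simp: forest_Nil forest_Cons)

lemma gcopies_mono: "A \<sqsubseteq> B \<Longrightarrow> gcopies t A \<sqsubseteq> gcopies t B"
  by (induction t) (auto intro: gunion_mono)

lemma spider_Nil_path: "spider [] \<sqsubseteq> P 1"
  by code_simp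

lemma isolated_sub: "forest (replicate k []) \<sqsubseteq> gcopies t (P 1)" if "k \<le> t"
  by (rule induced_sub_trans[OF forest_le_sub[of _ "replicate t []"]])
    (use that in \<open>simp_all flip: gcopies_eq_forest add: gcopies_mono[OF spider_Nil_path[unfolded One_nat_def]] del: spider.simps\<close>)

text \<open>Each family increases with \<open>t\<close>, so one containment with parameter
  \<open>k\<close> serves all large \<open>t\<close>. The hypotheses speak of forests because there
  containment follows from the computable \<open>forest_le\<close>, or from evaluation when
  \<open>k\<close> is a number.\<close>

lemma fits:
  "G \<sqsubseteq> forest (replicate k []) \<Longrightarrow> fits (\<lambda>t. gcopies t (P 1)) G"
  "G \<sqsubseteq> forest ([2] # replicate k []) \<Longrightarrow> fits (\<lambda>t. gcopies t (P 1) \<oplus> P 3) G"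
  "G \<sqsubseteq> forest [replicate k 1, []] \<Longrightarrow> fits (\<lambda>t. star_graph t \<oplus> P 1) G"
  "G \<sqsubseteq> forest [replicate k 1, replicate k 1] \<Longrightarrow> fits (\<lambda>t. gcopies 2 (star_graph t)) G"
  "G \<sqsubseteq> forest [2 # replicate k 1] \<Longrightarrow> fits star_plus G"
  "G \<sqsubseteq> forest [3 # replicate k 1, []] \<Longrightarrow> fits (\<lambda>t. star_pplus t \<oplus> P 1) G"
proof -
  have star: "spider (replicate k (Suc 0)) \<sqsubseteq> star_graph t" if "k \<le> t" for t
    using that graph_iso_imp_induced_sub[OF spider_star]
      rooted_sub_imp_induced_sub[OF legs_le_rooted_sub] legs_le_replicate induced_sub_trans by blast
  have two: "forest [a, b] = spider a \<oplus> forest [b]" for a b by (rule forest_Cons)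
  have one: "forest [c] \<sqsubseteq> spider c" for c using forest_single graph_iso_imp_induced_sub by blast
  have P1: "forest [[]] \<sqsubseteq> P 1" by code_simp
  have P3: "spider [2] \<sqsubseteq> P 3" by code_simp
  have sp: "spider (x # replicate k (Suc 0)) \<sqsubseteq> spider (x # replicate (t - Suc 0) (Suc 0))" if "Suc k \<le> t" for x t
    by (intro rooted_sub_imp_induced_sub legs_le_rooted_sub) (use that in auto)
  show "fits (\<lambda>t. gcopies t (P 1)) G" if "G \<sqsubseteq> forest (replicate k [])"
    unfolding fits_def using that isolated_sub induced_sub_trans by blast
  show "fits (\<lambda>t. gcopies t (P 1) \<oplus> P 3) G" if "G \<sqsubseteq> forest ([2] # replicate k [])"
  proof -
    have "G \<sqsubseteq> P 3 \<oplus> gcopies t (P 1)" if "k \<le> t" for t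
      using that \<open>G \<sqsubseteq> _\<close> gunion_mono[OF P3 isolated_sub] unfolding forest_Cons by (meson induced_sub_trans)
    then show ?thesis unfolding fits_def using gunion_comm_sub induced_sub_trans by blast
  qed
  show "fits (\<lambda>t. star_graph t \<oplus> P 1) G" if "G \<sqsubseteq> forest [replicate k 1, []]"
    unfolding fits_def using that gunion_mono[OF star P1] unfolding two One_nat_def by (meson induced_sub_trans)
  show "fits (\<lambda>t. gcopies 2 (star_graph t)) G" if "G \<sqsubseteq> forest [replicate k 1, replicate k 1]"
  proof -
    have "G \<sqsubseteq> gcopies 2 (spider (replicate k 1))"
      using that by (simp add: gcopies_eq_forest numeral_2_eq_2)
    then show ?thesis unfolding fits_def using gcopies_mono[OF star] by (metis One_nat_def induced_sub_trans)
  qed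
  show "fits star_plus G" if "G \<sqsubseteq> forest [2 # replicate k 1]"
    unfolding fits_def star_plus_def
    \<comment> \<open>\<open>star_plus t\<close> has \<open>t - 1\<close> legs of length 1, so there
      is room for \<open>k\<close> of them from \<open>Suc k\<close> on.\<close>
    by (rule exI[of _ "Suc k"]) (use that one sp[of _ 2] induced_sub_trans in \<open>simp only: One_nat_def, blast\<close>)
  show "fits (\<lambda>t. star_pplus t \<oplus> P 1) G" if "G \<sqsubseteq> forest [3 # replicate k 1, []]"
    unfolding fits_def star_pplus_def
    by (rule exI[of _ "Suc k"])
      (use that gunion_mono[OF sp[of _ 3] P1] induced_sub_trans in \<open>simp only: two One_nat_def, blast\<close>)
qed

text \<open>The profiles given by a single graph stay within this bound; \<open>4P_1\<close> attains
  it.\<close>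

lemmas fits_4 = fits[where k = 4]

text \<open>In the rule names, \<open>S1k\<close>, \<open>S21k\<close> and \<open>S31k\<close> are \<open>K\<^sub>1\<^sub>,\<^sub>k\<close>, \<open>K\<^sub>1\<^sub>,\<^sub>k\<^sup>+\<close> and \<open>K\<^sub>1\<^sub>,\<^sub>k\<^sup>+\<^sup>+\<close>, and \<open>Sabc\<close> is the spider with
  legs \<open>a, b, c\<close>. The premises of each rule are a selection, found by computer, of the containments that hold for
  the named graphs which still suffices to resolve all pairs of profiles but the six open ones.\<close>

inductive profile :: "graph \<Rightarrow> bool" where
  p_3P1: "graph_iso G (gcopies 3 (P 1)) \<Longrightarrow> gcopies 3 (P 1) \<sqsubseteq> G \<Longrightarrow> G \<sqsubseteq> gcopies 2 (P 1) \<oplus> P 2 \<Longrightarrow>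
      G \<sqsubseteq> P 1 \<oplus> P 3 \<Longrightarrow> G \<sqsubseteq> P 5 \<Longrightarrow> fits (\<lambda>t. gcopies t (P 1)) G \<Longrightarrow> profile G"
| p_4P1: "graph_iso G (gcopies 4 (P 1)) \<Longrightarrow> gcopies 3 (P 1) \<sqsubseteq> G \<Longrightarrow> gcopies 4 (P 1) \<sqsubseteq> G \<Longrightarrow>
      fits (\<lambda>t. gcopies t (P 1)) G \<Longrightarrow> fits (\<lambda>t. gcopies t (P 1) \<oplus> P 3) G \<Longrightarrow> profile G"
| p_5P1: "gcopies 3 (P 1) \<sqsubseteq> G \<Longrightarrow> gcopies 4 (P 1) \<sqsubseteq> G \<Longrightarrow> gcopies 5 (P 1) \<sqsubseteq> G \<Longrightarrow>
      fits (\<lambda>t. gcopies t (P 1)) G \<Longrightarrow> fits (\<lambda>t. gcopies t (P 1) \<oplus> P 3) G \<Longrightarrow> profile G"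
| p_2P2: "gcopies 2 (P 2) \<sqsubseteq> G \<Longrightarrow> G \<sqsubseteq> P 5 \<Longrightarrow> profile G"
| p_P6: "gcopies 2 (P 2) \<sqsubseteq> G \<Longrightarrow> P 1 \<oplus> P 4 \<sqsubseteq> G \<Longrightarrow> P 6 \<sqsubseteq> G \<Longrightarrow> G \<sqsubseteq> P 6 \<Longrightarrow> profile G"
| p_P7: "graph_iso G (P 7) \<Longrightarrow> gcopies 2 (P 2) \<sqsubseteq> G \<Longrightarrow> P 1 \<oplus> P 4 \<sqsubseteq> G \<Longrightarrow> P 2 \<oplus> P 4 \<sqsubseteq> G \<Longrightarrow> profile G"
| p_3P2: "gcopies 2 (P 2) \<sqsubseteq> G \<Longrightarrow> gcopies 3 (P 2) \<sqsubseteq> G \<Longrightarrow> profile G"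
| p_2P1_2P2: "gcopies 2 (P 1) \<oplus> gcopies 2 (P 2) \<sqsubseteq> G \<Longrightarrow> gcopies 2 (P 2) \<sqsubseteq> G \<Longrightarrow> profile G"
| p_P1_2P3: "gcopies 2 (P 2) \<sqsubseteq> G \<Longrightarrow> P 1 \<oplus> gcopies 2 (P 3) \<sqsubseteq> G \<Longrightarrow> profile G"
| p_2P1_P4: "gcopies 2 (P 1) \<oplus> P 2 \<sqsubseteq> G \<Longrightarrow> gcopies 2 (P 1) \<oplus> P 4 \<sqsubseteq> G \<Longrightarrow> gcopies 3 (P 1) \<sqsubseteq> G \<Longrightarrow>
      gcopies 3 (P 1) \<oplus> P 2 \<sqsubseteq> G \<Longrightarrow> P 1 \<oplus> P 4 \<sqsubseteq> G \<Longrightarrow> profile G"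
| p_S1k: "star_graph 3 \<sqsubseteq> G \<Longrightarrow> fits (\<lambda>t. gcopies 2 (star_graph t)) G \<Longrightarrow>
      fits (\<lambda>t. star_graph t \<oplus> P 1) G \<Longrightarrow> profile G"
| p_S21k: "gcopies 2 (P 1) \<oplus> P 2 \<sqsubseteq> G \<Longrightarrow> star_graph 3 \<sqsubseteq> G \<Longrightarrow> fits (star_plus) G \<Longrightarrow> profile G"
| p_S311: "graph_iso G (S_graph 1 1 3) \<Longrightarrow> gcopies 2 (P 2) \<sqsubseteq> G \<Longrightarrow> star_graph 3 \<sqsubseteq> G \<Longrightarrow>
      star_pplus 3 \<sqsubseteq> G \<Longrightarrow> fits (\<lambda>t. star_pplus t \<oplus> P 1) G \<Longrightarrow> profile G"
| p_S31k: "gcopies 2 (P 1) \<oplus> P 2 \<sqsubseteq> G \<Longrightarrow> star_graph 3 \<sqsubseteq> G \<Longrightarrow> star_pplus 4 \<sqsubseteq> G \<Longrightarrow>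
      fits (\<lambda>t. star_pplus t \<oplus> P 1) G \<Longrightarrow> profile G"
| p_S221: "gcopies 2 (P 1) \<oplus> P 2 \<sqsubseteq> G \<Longrightarrow> star_graph 3 \<sqsubseteq> G \<Longrightarrow> P 1 \<oplus> gcopies 2 (P 2) \<sqsubseteq> G \<Longrightarrow>
      G \<sqsubseteq> S_graph 1 2 2 \<Longrightarrow> profile G"
| p_S321: "graph_iso G (S_graph 1 2 3) \<Longrightarrow> gcopies 2 (P 2) \<sqsubseteq> G \<Longrightarrow> P 1 \<oplus> P 4 \<sqsubseteq> G \<Longrightarrow> P 6 \<sqsubseteq> G \<Longrightarrow> profile G"
| p_P1_P4: "graph_iso G (P 1 \<oplus> P 4) \<Longrightarrow> gcopies 2 (P 1) \<oplus> P 2 \<sqsubseteq> G \<Longrightarrow> gcopies 3 (P 1) \<sqsubseteq> G \<Longrightarrow>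
      P 1 \<oplus> P 4 \<sqsubseteq> G \<Longrightarrow> G \<sqsubseteq> P 1 \<oplus> P 4 \<Longrightarrow> profile G"
| p_P1_P5: "graph_iso G (P 1 \<oplus> P 5) \<Longrightarrow> gcopies 2 (P 2) \<sqsubseteq> G \<Longrightarrow> P 1 \<oplus> gcopies 2 (P 2) \<sqsubseteq> G \<Longrightarrow>
      fits (\<lambda>t. star_pplus t \<oplus> P 1) G \<Longrightarrow> profile G"
| p_S21k_P1: "gcopies 2 (P 1) \<oplus> P 2 \<sqsubseteq> G \<Longrightarrow> star_graph 3 \<sqsubseteq> G \<Longrightarrow> P 1 \<oplus> P 4 \<sqsubseteq> G \<Longrightarrow>
      fits (\<lambda>t. star_pplus t \<oplus> P 1) G \<Longrightarrow> profile G"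
| p_S31k_P1: "gcopies 2 (P 2) \<sqsubseteq> G \<Longrightarrow> star_graph 3 \<sqsubseteq> G \<Longrightarrow> P 1 \<oplus> P 4 \<sqsubseteq> G \<Longrightarrow>
      fits (\<lambda>t. star_pplus t \<oplus> P 1) G \<Longrightarrow> profile G"
| p_2P1_P2: "graph_iso G (gcopies 2 (P 1) \<oplus> P 2) \<Longrightarrow> gcopies 2 (P 1) \<oplus> P 2 \<sqsubseteq> G \<Longrightarrow>
      gcopies 3 (P 1) \<sqsubseteq> G \<Longrightarrow> G \<sqsubseteq> gcopies 2 (P 1) \<oplus> P 2 \<Longrightarrow> G \<sqsubseteq> gcopies 2 (P 1) \<oplus> P 3 \<Longrightarrow> G \<sqsubseteq> P 1 \<oplus> P 4 \<Longrightarrow>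
      fits (\<lambda>t. gcopies t (P 1) \<oplus> P 3) G \<Longrightarrow> profile G"
| p_2P1_P3: "gcopies 2 (P 1) \<oplus> P 2 \<sqsubseteq> G \<Longrightarrow> gcopies 3 (P 1) \<sqsubseteq> G \<Longrightarrow> gcopies 4 (P 1) \<sqsubseteq> G \<Longrightarrow>
      G \<sqsubseteq> gcopies 2 (P 1) \<oplus> P 3 \<Longrightarrow> fits (\<lambda>t. gcopies t (P 1) \<oplus> P 3) G \<Longrightarrow> profile G"
| p_sP1_P2: "gcopies 2 (P 1) \<oplus> P 2 \<sqsubseteq> G \<Longrightarrow> gcopies 3 (P 1) \<oplus> P 2 \<sqsubseteq> G \<Longrightarrow> gcopies 4 (P 1) \<sqsubseteq> G \<Longrightarrow>
      fits (\<lambda>t. gcopies 2 (star_graph t)) G \<Longrightarrow> fits (\<lambda>t. gcopies t (P 1) \<oplus> P 3) G \<Longrightarrow> profile G"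
| p_S1k_sP1: "gcopies 2 (P 1) \<oplus> P 2 \<sqsubseteq> G \<Longrightarrow> star_graph 3 \<sqsubseteq> G \<Longrightarrow>
      fits (\<lambda>t. gcopies 2 (star_graph t)) G \<Longrightarrow> profile G"
| p_P2_P3: "graph_iso G (P 2 \<oplus> P 3) \<Longrightarrow> gcopies 2 (P 2) \<sqsubseteq> G \<Longrightarrow> G \<sqsubseteq> P 2 \<oplus> P 3 \<Longrightarrow>
      fits (\<lambda>t. gcopies 2 (star_graph t)) G \<Longrightarrow> profile G"
| p_S1k_P2: "gcopies 2 (P 2) \<sqsubseteq> G \<Longrightarrow> star_graph 3 \<sqsubseteq> G \<Longrightarrow>
      fits (\<lambda>t. gcopies 2 (star_graph t)) G \<Longrightarrow> profile G"
| p_S1a_S1b: "gcopies 2 (P 2) \<sqsubseteq> G \<Longrightarrow> gcopies 2 (P 3) \<sqsubseteq> G \<Longrightarrow>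
      fits (\<lambda>t. gcopies 2 (star_graph t)) G \<Longrightarrow> profile G"
| p_P2_P4: "gcopies 2 (P 2) \<sqsubseteq> G \<Longrightarrow> P 1 \<oplus> gcopies 2 (P 2) \<sqsubseteq> G \<Longrightarrow> P 2 \<oplus> P 4 \<sqsubseteq> G \<Longrightarrow>
      G \<sqsubseteq> P 2 \<oplus> P 4 \<Longrightarrow> profile G"
| p_P1_2P2: "gcopies 2 (P 2) \<sqsubseteq> G \<Longrightarrow> P 1 \<oplus> gcopies 2 (P 2) \<sqsubseteq> G \<Longrightarrow>
      G \<sqsubseteq> P 1 \<oplus> gcopies 2 (P 2) \<Longrightarrow> profile G"
| p_P1_P2_P3: "graph_iso G (P 1 \<oplus> P 2 \<oplus> P 3) \<Longrightarrow> gcopies 2 (P 2) \<sqsubseteq> G \<Longrightarrow> P 1 \<oplus> gcopies 2 (P 2) \<sqsubseteq> G \<Longrightarrow>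
      fits (\<lambda>t. star_pplus t \<oplus> P 1) G \<Longrightarrow> profile G"
| p_S1k_P2_P1: "gcopies 2 (P 2) \<sqsubseteq> G \<Longrightarrow> star_graph 3 \<sqsubseteq> G \<Longrightarrow> P 1 \<oplus> gcopies 2 (P 2) \<sqsubseteq> G \<Longrightarrow>
      fits (\<lambda>t. star_pplus t \<oplus> P 1) G \<Longrightarrow> profile G"

section \<open>Entry points into the profiles\<close>

lemma profile_3P1: "graph_iso G (forest [[], [], []]) \<Longrightarrow> profile G"
  by (rule p_3P1; (rule fits_4)?, erule iso_transfer, code_simp)

lemma profile_4P1: "graph_iso G (forest [[], [], [], []]) \<Longrightarrow> profile G"
  by (rule p_4P1; (rule fits_4)?, erule iso_transfer, code_simp)

text \<open>A whole family is treated at once: lower containments are evaluated on its smallest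
  member and carried up by transitivity, upper ones come from the bound with parameter
  \<open>k\<close>. The later lemmas with a parameter follow the same pattern.\<close>

lemma profile_5P1:
  assumes "forest [[], [], [], [], []] \<sqsubseteq> G"
    "G \<sqsubseteq> forest (replicate k [])"
    "G \<sqsubseteq> forest ([2] # replicate k [])"
  shows "profile G"
  by (rule p_5P1; ((rule induced_sub_trans[OF _ assms(1)], code_simp) | (rule fits, rule assms)))

lemma profile_2P2: "graph_iso G (forest [[1], [1]]) \<Longrightarrow> profile G"
  by (rule p_2P2; erule iso_transfer, code_simp)

text \<open>The rule for \<open>2P_2\<close> asks only for a graph between \<open>2P_2\<close> and
  \<open>P_5\<close>, so both ends of that interval share it.\<close>

lemma profile_P5: "graph_iso G (forest [[4]]) \<Longrightarrow> profile G"
  by (rule p_2P2; erule iso_transfer, code_simp)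

lemma profile_P6: "graph_iso G (forest [[5]]) \<Longrightarrow> profile G"
  by (rule p_P6; erule iso_transfer, code_simp)

lemma profile_P7: "graph_iso G (forest [[6]]) \<Longrightarrow> profile G"
  by (rule p_P7; erule iso_transfer, code_simp)

text \<open>For the absorbing graphs of (k) lower containments are enough. This lemma and the next
  three therefore apply to every supergraph, and dispose of all forests that are too large.\<close>

lemma profile_3P2: "forest [[1], [1], [1]] \<sqsubseteq> G \<Longrightarrow> profile G"
  by (rule p_3P2; erule induced_sub_trans[rotated], code_simp)

lemma profile_2P1_2P2: "forest [[1], [1], [], []] \<sqsubseteq> G \<Longrightarrow> profile G"
  by (rule p_2P1_2P2; erule induced_sub_trans[rotated], code_simp)

lemma profile_P1_2P3: "forest [[2], [2], []] \<sqsubseteq> G \<Longrightarrow> profile G"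
  by (rule p_P1_2P3; erule induced_sub_trans[rotated], code_simp)

lemma profile_2P1_P4: "forest [[3], [], []] \<sqsubseteq> G \<Longrightarrow> profile G"
  by (rule p_2P1_P4; erule induced_sub_trans[rotated], code_simp)

lemma profile_S1k:
  assumes "forest [[1, 1, 1]] \<sqsubseteq> G"
    "G \<sqsubseteq> forest [replicate k 1, replicate k 1]"
    "G \<sqsubseteq> forest [replicate k 1, []]"
  shows "profile G"
  by (rule p_S1k; ((rule induced_sub_trans[OF _ assms(1)], code_simp) | (rule fits, rule assms)))

lemma profile_S21k:
  assumes "forest [[2, 1, 1]] \<sqsubseteq> G"
    "G \<sqsubseteq> forest [2 # replicate k 1]"
  shows "profile G"
  by (rule p_S21k; ((rule induced_sub_trans[OF _ assms(1)], code_simp) | (rule fits, rule assms)))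

lemma profile_S311: "graph_iso G (forest [[3, 1, 1]]) \<Longrightarrow> profile G"
  by (rule p_S311; (rule fits_4)?, erule iso_transfer, code_simp)

lemma profile_S31k:
  assumes "forest [[3, 1, 1, 1]] \<sqsubseteq> G"
    "G \<sqsubseteq> forest [3 # replicate k 1, []]"
  shows "profile G"
  by (rule p_S31k; ((rule induced_sub_trans[OF _ assms(1)], code_simp) | (rule fits, rule assms)))

lemma profile_S221: "graph_iso G (forest [[2, 2, 1]]) \<Longrightarrow> profile G"
  by (rule p_S221; erule iso_transfer, code_simp)

lemma profile_S321: "graph_iso G (forest [[3, 2, 1]]) \<Longrightarrow> profile G"
  by (rule p_S321; erule iso_transfer, code_simp)

lemma profile_P1_P4: "graph_iso G (forest [[3], []]) \<Longrightarrow> profile G"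
  by (rule p_P1_P4; erule iso_transfer, code_simp)

lemma profile_P1_P5: "graph_iso G (forest [[4], []]) \<Longrightarrow> profile G"
  by (rule p_P1_P5; (rule fits_4)?, erule iso_transfer, code_simp)

lemma profile_S21k_P1:
  assumes "forest [[2, 1, 1], []] \<sqsubseteq> G"
    "G \<sqsubseteq> forest [3 # replicate k 1, []]"
  shows "profile G"
  by (rule p_S21k_P1; ((rule induced_sub_trans[OF _ assms(1)], code_simp) | (rule fits, rule assms)))

lemma profile_S31k_P1:
  assumes "forest [[3, 1, 1], []] \<sqsubseteq> G"
    "G \<sqsubseteq> forest [3 # replicate k 1, []]"
  shows "profile G"
  by (rule p_S31k_P1; ((rule induced_sub_trans[OF _ assms(1)], code_simp) | (rule fits, rule assms)))

lemma profile_2P1_P2: "graph_iso G (forest [[1], [], []]) \<Longrightarrow> profile G"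
  by (rule p_2P1_P2; (rule fits_4)?, erule iso_transfer, code_simp)

lemma profile_2P1_P3: "graph_iso G (forest [[2], [], []]) \<Longrightarrow> profile G"
  by (rule p_2P1_P3; (rule fits_4)?, erule iso_transfer, code_simp)

lemma profile_sP1_P2:
  assumes "forest [[1], [], [], []] \<sqsubseteq> G"
    "G \<sqsubseteq> forest [replicate k 1, replicate k 1]"
    "G \<sqsubseteq> forest ([2] # replicate k [])"
  shows "profile G"
  by (rule p_sP1_P2; ((rule induced_sub_trans[OF _ assms(1)], code_simp) | (rule fits, rule assms)))

lemma profile_sP1_P3:
  assumes "forest [[2], [], [], []] \<sqsubseteq> G"
    "G \<sqsubseteq> forest [replicate k 1, replicate k 1]"
    "G \<sqsubseteq> forest ([2] # replicate k [])"
  shows "profile G"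
  by (rule p_sP1_P2; ((rule induced_sub_trans[OF _ assms(1)], code_simp) | (rule fits, rule assms)))

lemma profile_S1k_sP1:
  assumes "forest [[1, 1, 1], [], []] \<sqsubseteq> G"
    "G \<sqsubseteq> forest [replicate k 1, replicate k 1]"
  shows "profile G"
  by (rule p_S1k_sP1; ((rule induced_sub_trans[OF _ assms(1)], code_simp) | (rule fits, rule assms)))

lemma profile_P2_P3: "graph_iso G (forest [[2], [1]]) \<Longrightarrow> profile G"
  by (rule p_P2_P3; (rule fits_4)?, erule iso_transfer, code_simp)

lemma profile_S1k_P2:
  assumes "forest [[1, 1, 1], [1]] \<sqsubseteq> G"
    "G \<sqsubseteq> forest [replicate k 1, replicate k 1]"
  shows "profile G"
  by (rule p_S1k_P2; ((rule induced_sub_trans[OF _ assms(1)], code_simp) | (rule fits, rule assms)))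

lemma profile_S1a_S1b:
  assumes "forest [[2], [2]] \<sqsubseteq> G"
    "G \<sqsubseteq> forest [replicate k 1, replicate k 1]"
  shows "profile G"
  by (rule p_S1a_S1b; ((rule induced_sub_trans[OF _ assms(1)], code_simp) | (rule fits, rule assms)))

lemma profile_P2_P4: "graph_iso G (forest [[3], [1]]) \<Longrightarrow> profile G"
  by (rule p_P2_P4; erule iso_transfer, code_simp)

lemma profile_P1_2P2: "graph_iso G (forest [[1], [1], []]) \<Longrightarrow> profile G"
  by (rule p_P1_2P2; erule iso_transfer, code_simp)

lemma profile_P1_P2_P3: "graph_iso G (forest [[2], [1], []]) \<Longrightarrow> profile G"
  by (rule p_P1_P2_P3; (rule fits_4)?, erule iso_transfer, code_simp)

lemma profile_S1k_P2_P1: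
  assumes "forest [[1, 1, 1], [1], []] \<sqsubseteq> G"
    "G \<sqsubseteq> forest [3 # replicate k 1, []]"
  shows "profile G"
  by (rule p_S1k_P2_P1; ((rule induced_sub_trans[OF _ assms(1)], code_simp) | (rule fits, rule assms)))

section \<open>Every path star forest has a profile\<close>

declare spider.simps(2) [simp del]

section \<open>Auxiliary embeddings and normal forms\<close>

lemma forest_cong: "list_all2 (\<lambda>x y. spider x \<sqsubseteq> spider y) xs ys \<Longrightarrow> forest xs \<sqsubseteq> forest ys"
  by (induction rule: list_all2_induct) (auto simp: forest_Cons intro: gunion_mono)

lemma forest_isolated: "fst (forest (replicate s [])) = s" "\<not> snd (forest (replicate s [])) u v"
  by (induction s arbitrary: u v) (auto simp: forest_Nil forest_Cons null_graph_def gunion_def)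

text \<open>The leaves of a star are independent; \<open>Suc\<close> passes over the centre.\<close>

lemma isolated_in_star: "forest (replicate s []) \<sqsubseteq> spider (replicate s 1)"
  unfolding induced_sub_def forest_isolated(1)
  by (intro exI[of _ Suc]) (auto simp: forest_isolated(2) spider_star_adj fst_spider sum_list_replicate)

text \<open>One star hosts the component, and the leaves of the other host the isolated vertices.
  Taking \<open>max m s\<close> makes the two stars equal, as (d) demands.\<close>

lemma two_stars_upper:
  assumes "spider c \<sqsubseteq> spider (replicate m 1)"
  shows "forest (c # replicate s []) \<sqsubseteq> forest [replicate (max m s) 1, replicate (max m s) 1]"
proof -
  have le: "spider (replicate a 1) \<sqsubseteq> spider (replicate b 1)" if "a \<le> b" for a b
    by (intro rooted_sub_imp_induced_sub legs_le_rooted_sub) (use that in simp)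
  have "spider c \<sqsubseteq> spider (replicate (max m s) 1)"
    by (rule induced_sub_trans[OF assms le]) simp
  moreover have "forest (replicate s []) \<sqsubseteq> spider (replicate (max m s) 1)"
    by (rule induced_sub_trans[OF isolated_in_star le]) simp
  then have "forest (replicate s []) \<sqsubseteq> forest [replicate (max m s) 1]"
    using forest_single graph_iso_iff_mutual induced_sub_trans by blast
  ultimately show ?thesis unfolding forest_Cons[of c] forest_Cons[of _ "[_]"] by (rule gunion_mono)
qed

text \<open>Deleting the vertex of the leg next to the centre detaches the rest of that leg. Of its
  \<open>l + 2\<close> vertices a path on \<open>l + 1\<close> vertices is left, and that is
  \<open>spider [l]\<close>; the map skips the deleted vertex \<open>n\<close>.\<close>

lemma spider_cut: "spider ls \<oplus> spider [l] \<sqsubseteq> spider (Suc (Suc l) # ls)"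
proof -
  define n where "n = fst (spider ls)"
  define h where "h u = (if u < n then u else Suc u)" for u
  have fst: "fst (spider ls \<oplus> spider [l]) = n + Suc l" "fst (spider (Suc (Suc l) # ls)) = n + Suc (Suc l)"
    by (simp_all add: n_def gunion_def fst_spider)
  have n: "0 < n" by (simp add: n_def spider_pos)
  have "inj_on h {..<n + Suc l}" by (auto simp: inj_on_def h_def split: if_splits)
  moreover have "h ` {..<n + Suc l} \<subseteq> {..<n + Suc (Suc l)}" by (auto simp: h_def)
  moreover have "snd (spider ls \<oplus> spider [l]) u v \<longleftrightarrow> snd (spider (Suc (Suc l) # ls)) (h u) (h v)"
    if "u < n + Suc l" "v < n + Suc l" for u v
  proof -
    have old: "\<not> snd (spider ls) x y" if "\<not> x < n \<or> \<not> y < n" for x y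
      using spider_adj_less[of ls x y] that by (auto simp: n_def)
    show ?thesis
      unfolding spider_Cons_adj[of "Suc (Suc l)"] leg_edge_def gunion_def n_def[symmetric] snd_conv spider_single_adj
      using that n old[of "h u" "h v"] by (cases "u < n"; cases "v < n") (auto simp: h_def)
  qed
  ultimately show ?thesis unfolding induced_sub_def fst by blast
qed

text \<open>The first six shapes are exact. The last four are lower bounds chosen so that each
  contains a graph of (k): \<open>[2, 2, 2]\<close> and \<open>[3, 3, 1]\<close> contain 3P_2,
  \<open>[2, 2, 1, 1]\<close> contains 2P_1+2P_2, and \<open>[4, 1, 1]\<close> contains
  2P_1+P_4.\<close>

definition normal_legs :: "nat list \<Rightarrow> bool" where
  "normal_legs d \<longleftrightarrow> (\<exists>r. d = [Suc r]) \<or> (\<exists>k. d = replicate (k + 3) 1) \<or> (\<exists>k. d = 2 # replicate (k + 2) 1) \<or>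
     (\<exists>k. d = 3 # replicate (k + 2) 1) \<or> d = [2, 2, 1] \<or> d = [3, 2, 1] \<or>
     legs_le [2, 2, 2] d \<or> legs_le [2, 2, 1, 1] d \<or> legs_le [3, 3, 1] d \<or> legs_le [4, 1, 1] d"

text \<open>In descending order the second leg decides: if it is 1, so are all later ones and only
  \<open>x\<close> varies. Otherwise a third leg of at least 2 gives \<open>[2, 2, 2]\<close>, a
  fourth leg gives \<open>[2, 2, 1, 1]\<close>, and three legs ending in 1 are compared by
  \<open>x\<close> and \<open>y\<close>.\<close>

lemma normal_legs_sorted:
  assumes "sorted_wrt (\<ge>) (x # y # z # r)" "\<forall>l\<in>set (x # y # z # r). 0 < (l::nat)"
  shows "normal_legs (x # y # z # r)"
proof (cases "y = 1")
  case True
  then have "\<forall>l\<in>set (y # z # r). l = 1" using assms by fastforce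
  then have "y # z # r = replicate (length (y # z # r)) 1" by (metis replicate_eqI)
  then have eq: "y # z # r = replicate (length r + 2) 1" by simp
  have "x = 1 \<or> x = 2 \<or> x = 3 \<or> 4 \<le> x" using assms(2) by auto
  moreover have "x = 1 \<Longrightarrow> x # y # z # r = replicate (length r + 3) 1" using eq by (simp add: numeral_3_eq_3)
  moreover have "4 \<le> x \<Longrightarrow> legs_le [4, 1, 1] (x # y # z # r)" using assms(2) by (auto simp: Suc_le_eq)
  ultimately show ?thesis unfolding normal_legs_def eq by metis
next
  case False
  then have y: "2 \<le> y" "y \<le> x" "z \<le> y" "0 < z" using assms by auto
  show ?thesis
  proof (cases "z = 1")
    case True
    show ?thesis
    proof (cases r)
      case Nil
      consider "x = 2" "y = 2" | "x = 3" "y = 2" | "3 \<le> y" | "4 \<le> x" using y by linarith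
      then show ?thesis using y True Nil unfolding normal_legs_def by cases auto
    next
      case (Cons w q)
      then have "legs_le [2, 2, 1, 1] (x # y # z # r)" using y True assms(2) by (auto simp: Suc_le_eq)
      then show ?thesis unfolding normal_legs_def by blast
    qed
  next
    case False
    then have "legs_le [2, 2, 2] (x # y # z # r)" using y by auto
    then show ?thesis unfolding normal_legs_def by blast
  qed
qed

text \<open>Sorting the legs is harmless by \<open>spider_perm\<close>. A centre with at most two
  legs is no branch vertex, so such a spider is an isolated vertex or a path with a single
  leg.\<close>

lemma normal_component:
  assumes "\<forall>l\<in>set c. 0 < l"
  shows "\<exists>d. graph_iso (spider c) (spider d) \<and> (d = [] \<or> normal_legs d)"
proof -
  define c' where "c' = rev (sort c)"
  have "mset c' = mset c" by (simp add: c'_def)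
  then have iso: "graph_iso (spider c) (spider c')"
    using spider_perm[of c c'] spider_perm[of c' c] rooted_sub_imp_induced_sub graph_iso_iff_mutual by metis
  have c': "sorted_wrt (\<ge>) c'" "\<forall>l\<in>set c'. 0 < l"
    using assms by (auto simp: c'_def sorted_wrt_rev)
  consider "c' = []" | a where "c' = [a]" | a b where "c' = [a, b]" | x y z r where "c' = x # y # z # r"
    by (metis neq_Nil_conv)
  then show ?thesis
  proof cases
    case 1 then show ?thesis using iso by blast
  next
    case (2 a)
    then have "normal_legs c'" using c'(2) by (auto simp: normal_legs_def gr0_conv_Suc)
    then show ?thesis using iso by blast
  next
    case (3 a b)
    have "normal_legs [a + b]" using c'(2) 3 by (auto simp: normal_legs_def gr0_conv_Suc)
    moreover have "graph_iso (spider c) (spider [a + b])"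
      using iso spider_two_legs[of a b] c'(2) 3 graph_iso_trans by (metis list.set_intros)
    ultimately show ?thesis by blast
  next
    case (4 x y z r)
    then show ?thesis using iso normal_legs_sorted[of x y z r] c' by metis
  qed
qed

lemma path_star_forest_normal_form:
  assumes "path_star_forest G"
  obtains ds s where "graph_iso G (forest (ds @ replicate s []))" "\<forall>d\<in>set ds. normal_legs d"
proof -
  obtain lss where lss: "\<forall>ls\<in>set lss. \<forall>l\<in>set ls. 0 < l" "graph_iso G (forest lss)"
    using assms unfolding path_star_forest_def forest_def by blast
  then obtain N where N: "\<And>c. c \<in> set lss \<Longrightarrow> graph_iso (spider c) (spider (N c)) \<and> (N c = [] \<or> normal_legs (N c))"
    using normal_component by metis
  define ds s where "ds = filter (\<lambda>d. d \<noteq> []) (map N lss)" and "s = length (filter (\<lambda>d. [] = d) (map N lss))"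
  have "forest lss \<sqsubseteq> forest (map N lss)"
    by (rule forest_cong) (use N graph_iso_iff_mutual in \<open>simp add: list_all2_conv_all_nth\<close>)
  moreover have "forest (map N lss) \<sqsubseteq> forest lss"
    by (rule forest_cong) (use N graph_iso_iff_mutual in \<open>simp add: list_all2_conv_all_nth\<close>)
  moreover have "mset (ds @ replicate s []) = mset (map N lss)"
    unfolding ds_def s_def by (induction lss) auto
  then have "forest (map N lss) \<sqsubseteq> forest (ds @ replicate s [])" "forest (ds @ replicate s []) \<sqsubseteq> forest (map N lss)"
    by (simp_all add: forest_perm)
  ultimately have "graph_iso G (forest (ds @ replicate s []))"
    using lss(2) graph_iso_iff_mutual induced_sub_trans by metis
  moreover have "\<forall>d\<in>set ds. normal_legs d" using N by (auto simp: ds_def)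
  ultimately show ?thesis by (rule that)
qed

section \<open>Case analysis by the components that have edges\<close>

lemma iso_forest_lower:
  "graph_iso G (forest ys) \<Longrightarrow> forest_le xs ys \<Longrightarrow> forest xs \<sqsubseteq> G"
  using iso_transfer(2) forest_le_sub by blast

lemma iso_forest_upper:
  "graph_iso G (forest xs) \<Longrightarrow> forest_le xs ys \<Longrightarrow> G \<sqsubseteq> forest ys"
  using iso_transfer(3) forest_le_sub by blast

lemma classify_edgeless:
  assumes I: "graph_iso G (forest (replicate s []))"
  shows "G \<sqsubseteq> P 4 \<or> profile G"
proof -
  consider "s = 0" | "s = 1" | "s = 2" | "s = 3" | "s = 4" | r where "s = Suc (Suc (Suc (Suc (Suc r))))"
    by (metis One_nat_def numeral_2_eq_2 numeral_3_eq_3 eval_nat_numeral(2) semiring_norm(26,27) old.nat.exhaust)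
  then show ?thesis
  proof cases
    case 1 have "forest (replicate s []) \<sqsubseteq> P 4" unfolding 1 by code_simp
    then show ?thesis using I iso_transfer(3) by blast
  next
    case 2 have "forest (replicate s []) \<sqsubseteq> P 4" unfolding 2 by code_simp
    then show ?thesis using I iso_transfer(3) by blast
  next
    case 3 have "forest (replicate s []) \<sqsubseteq> P 4" unfolding 3 by code_simp
    then show ?thesis using I iso_transfer(3) by blast
  next
    case 4 then show ?thesis using profile_3P1[of G] I by (simp add: numeral_3_eq_3)
  next
    case 5 then show ?thesis using profile_4P1[of G] I by (simp add: numeral_eq_Suc)
  next
    case (6 r)
    have "forest (replicate s []) \<sqsubseteq> forest ([2] # replicate s [])"
      by (rule forest_le_sub) simp
    then have "profile G"
      using profile_5P1[of G s] I iso_transfer(3)[OF I] iso_forest_lower[OF I, of "[[], [], [], [], []]"] 6 by simp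
    then show ?thesis ..
  qed
qed

lemma normal_legs_cases [consumes 1, case_names path star plus pplus S221 S321 S222 S2211 S331 S411]:
  assumes "normal_legs d"
  obtains r where "d = [Suc r]" | k where "d = replicate (k + 3) 1" | k where "d = 2 # replicate (k + 2) 1"
  | k where "d = 3 # replicate (k + 2) 1" | "d = [2, 2, 1]" | "d = [3, 2, 1]"
  | "legs_le [2, 2, 2] d" | "legs_le [2, 2, 1, 1] d" | "legs_le [3, 3, 1] d" | "legs_le [4, 1, 1] d"
  using assms unfolding normal_legs_def by blast

lemma legs_le_Cons_iff: "legs_le (a # as) ys \<longleftrightarrow> (\<exists>b bs. ys = b # bs \<and> a \<le> b \<and> legs_le as bs)"
  by (cases ys) auto

lemma spider_sub_legs_le: "legs_le xs ys \<Longrightarrow> spider xs \<sqsubseteq> spider ys"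
  by (intro rooted_sub_imp_induced_sub legs_le_rooted_sub)

text \<open>The cut is dictated by paths: \<open>[Suc r]\<close> is the path on \<open>r + 2\<close>
  vertices, P_7 is the longest with a profile of its own, and P_8 contains 3P_2.\<close>

lemma nat_cases_upto_5:
  fixes n :: nat
  obtains "n = 0" | "n = 1" | "n = 2" | "n = 3" | "n = 4" | "n = 5" | m where "n = Suc (Suc (Suc (Suc (Suc (Suc m)))))"
proof (cases "6 \<le> n")
  case True
  then have "n = Suc (Suc (Suc (Suc (Suc (Suc (n - 6))))))" by simp
  then show ?thesis by (rule that(7))
next
  case False
  then have "n = 0 \<or> n = 1 \<or> n = 2 \<or> n = 3 \<or> n = 4 \<or> n = 5" by linarith
  then show ?thesis using that by blast
qed

lemma classify_connected:
  assumes "normal_legs d" and I: "graph_iso G (forest [d])"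
  shows "G \<sqsubseteq> P 4 \<or> profile G"
  using assms(1)
proof (cases rule: normal_legs_cases)
  case (path r)
  show ?thesis
  proof (cases r rule: nat_cases_upto_5)
    case 1
    have "forest [[1]] \<sqsubseteq> P 4" by code_simp
    then show ?thesis using iso_transfer(3)[OF I] path 1 by simp
  next
    case 2
    have "forest [[2]] \<sqsubseteq> P 4" by code_simp
    then show ?thesis using iso_transfer(3)[OF I] path 2 by (simp add: numeral_2_eq_2)
  next
    case 3
    have "forest [[3]] \<sqsubseteq> P 4" by code_simp
    then show ?thesis using iso_transfer(3)[OF I] path 3 by simp
  next
    case 4 then show ?thesis using profile_P5[of G] I path by simp
  next
    case 5 then show ?thesis using profile_P6[of G] I path by simp
  next
    case 6 then show ?thesis using profile_P7[of G] I path by simp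
  next
    case (7 m)
    have "forest [[1], [1], [1]] \<sqsubseteq> forest [[7]]" by code_simp
    moreover have "forest [[7]] \<sqsubseteq> G" by (rule iso_forest_lower[OF I]) (simp add: path 7)
    ultimately show ?thesis using profile_3P2 induced_sub_trans by blast
  qed
next
  case (star k)
  have "forest [[1, 1, 1]] \<sqsubseteq> G" by (rule iso_forest_lower[OF I]) (simp add: star numeral_3_eq_3)
  then show ?thesis using profile_S1k[of G "k + 3"] iso_forest_upper[OF I] star by simp
next
  case (plus k)
  have "forest [[2, 1, 1]] \<sqsubseteq> G" by (rule iso_forest_lower[OF I]) (simp add: plus)
  then show ?thesis using profile_S21k[of G "k + 2"] iso_forest_upper[OF I] plus by simp
next
  case (pplus k)
  show ?thesis
  proof (cases k)
    case 0 then show ?thesis using profile_S311[of G] I pplus by (simp add: numeral_2_eq_2)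
  next
    case (Suc k')
    have "forest [[3, 1, 1, 1]] \<sqsubseteq> G" by (rule iso_forest_lower[OF I]) (simp add: pplus Suc)
    then show ?thesis using profile_S31k[of G "k + 2"] iso_forest_upper[OF I] pplus by simp
  qed
next
  case S221 then show ?thesis using profile_S221 I by simp
next
  case S321 then show ?thesis using profile_S321 I by simp
next
  case S222
  have "forest [[1], [1], [1]] \<sqsubseteq> forest [[2, 2, 2]]" by code_simp
  moreover have "forest [[2, 2, 2]] \<sqsubseteq> G" by (rule iso_forest_lower[OF I]) (simp add: S222)
  ultimately show ?thesis using profile_3P2 induced_sub_trans by blast
next
  case S2211
  have "forest [[1], [1], [], []] \<sqsubseteq> forest [[2, 2, 1, 1]]" by code_simp
  moreover have "forest [[2, 2, 1, 1]] \<sqsubseteq> G" by (rule iso_forest_lower[OF I]) (simp add: S2211 del: One_nat_def)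
  ultimately show ?thesis using profile_2P1_2P2 induced_sub_trans by blast
next
  case S331
  have "forest [[1], [1], [1]] \<sqsubseteq> forest [[3, 3, 1]]" by code_simp
  moreover have "forest [[3, 3, 1]] \<sqsubseteq> G" by (rule iso_forest_lower[OF I]) (simp add: S331 del: One_nat_def)
  ultimately show ?thesis using profile_3P2 induced_sub_trans by blast
next
  case S411
  have "forest [[3], [], []] \<sqsubseteq> forest [[4, 1, 1]]" by code_simp
  moreover have "forest [[4, 1, 1]] \<sqsubseteq> G" by (rule iso_forest_lower[OF I]) (simp add: S411 del: One_nat_def)
  ultimately show ?thesis using profile_2P1_P4 induced_sub_trans by blast
qed

text \<open>The extra vertex makes the absorbing graphs appear earlier: P_1+P_6 already contains
  2P_1+P_4, and \<open>[2, 2, 1]\<close> with an isolated vertex contains 2P_1+2P_2. This is also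
  the one place where P_1+P_3 arises.\<close>

lemma classify_connected_plus_vertex:
  assumes "normal_legs d" and I: "graph_iso G (forest [d, []])"
  shows "G \<sqsubseteq> P 4 \<or> graph_iso G (P 1 \<oplus> P 3) \<or> profile G"
proof -
  have S221: ?thesis if "legs_le [2, 2, 1] d"
  proof -
    have "forest [[1], [1], [], []] \<sqsubseteq> forest [[2, 2, 1], []]" by code_simp
    moreover have "forest [[2, 2, 1], []] \<sqsubseteq> G" by (rule iso_forest_lower[OF I]) (simp add: that del: One_nat_def)
    ultimately show ?thesis using profile_2P1_2P2 induced_sub_trans by blast
  qed
  from assms(1) show ?thesis
  proof (cases rule: normal_legs_cases)
    case (path r)
    show ?thesis
    proof (cases r rule: nat_cases_upto_5)
      case 1
      have "forest [[1], []] \<sqsubseteq> P 4" by code_simp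
      then show ?thesis using iso_transfer(3)[OF I] path 1 by simp
    next
      case 2
      have "graph_iso (forest [[2], []]) (P 1 \<oplus> P 3)" by code_simp
      then show ?thesis using iso_transfer(1)[OF I] path 2 by (simp add: numeral_2_eq_2)
    next
      case 3 then show ?thesis using profile_P1_P4[of G] I path by simp
    next
      case 4 then show ?thesis using profile_P1_P5[of G] I path by simp
    next
      case 5
      have "forest [[3], [], []] \<sqsubseteq> forest [[5], []]" by code_simp
      then show ?thesis using profile_2P1_P4 iso_transfer(2)[OF I] path 5 by simp
    next
      case 6
      have "forest [[3], [], []] \<sqsubseteq> forest [[6], []]" by code_simp
      then show ?thesis using profile_2P1_P4 iso_transfer(2)[OF I] path 6 by simp
    next
      case (7 m)
      have "forest [[3], [], []] \<sqsubseteq> forest [[5], []]" by code_simp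
      moreover have "forest [[5], []] \<sqsubseteq> G" by (rule iso_forest_lower[OF I]) (simp add: path 7)
      ultimately show ?thesis using profile_2P1_P4 induced_sub_trans by blast
    qed
  next
    case (star k)
    have "forest [[1, 1, 1]] \<sqsubseteq> G" by (rule iso_forest_lower[OF I]) (simp add: star numeral_3_eq_3)
    then show ?thesis using profile_S1k[of G "k + 3"] iso_forest_upper[OF I] star by simp
  next
    case (plus k)
    have "forest [[2, 1, 1], []] \<sqsubseteq> G" by (rule iso_forest_lower[OF I]) (simp add: plus)
    then show ?thesis using profile_S21k_P1[of G "k + 2"] iso_forest_upper[OF I] plus by simp
  next
    case (pplus k)
    have "forest [[3, 1, 1], []] \<sqsubseteq> G" by (rule iso_forest_lower[OF I]) (simp add: pplus)
    then show ?thesis using profile_S31k_P1[of G "k + 2"] iso_forest_upper[OF I] pplus by simp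
  next
    case S411
    have "forest [[3], [], []] \<sqsubseteq> forest [[4, 1, 1]]" by code_simp
    moreover have "forest [[4, 1, 1]] \<sqsubseteq> G" by (rule iso_forest_lower[OF I]) (simp add: S411 del: One_nat_def)
    ultimately show ?thesis using profile_2P1_P4 induced_sub_trans by blast
  qed (rule S221, (auto simp: legs_le_Cons_iff)[1])+
qed

text \<open>With at least two isolated vertices, any P_4 in the component completes a 2P_1+P_4. The
  spider \<open>[2, 1, 1]\<close> contains P_4, so only P_2, P_3 and stars escape.\<close>

lemma classify_connected_plus_isolated:
  assumes "normal_legs d" and I: "graph_iso G (forest (d # replicate (s + 2) []))"
  shows "profile G"
proof -
  have S211: ?thesis if "legs_le [2, 1, 1] d"
  proof -
    have "forest [[3], [], []] \<sqsubseteq> forest [[2, 1, 1], [], []]" by code_simp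
    moreover have "forest [[2, 1, 1], [], []] \<sqsubseteq> G" by (rule iso_forest_lower[OF I]) (simp add: that del: One_nat_def)
    ultimately show ?thesis using profile_2P1_P4 induced_sub_trans by blast
  qed
  have up: "G \<sqsubseteq> forest [replicate m 1, replicate m 1]" if "spider d \<sqsubseteq> spider (replicate k 1)" "m = max k (s + 2)" for k m
    using iso_transfer(3)[OF I two_stars_upper[OF that(1)]] that(2) by simp
  from assms(1) show ?thesis
  proof (cases rule: normal_legs_cases)
    case (path r)
    consider "r = 0" "s = 0" | s' where "r = 0" "s = Suc s'" | "r = 1" "s = 0" | s' where "r = 1" "s = Suc s'"
      | r' where "r = Suc (Suc r')" by (metis One_nat_def not0_implies_Suc)
    then show ?thesis
    proof cases
      case 1 then show ?thesis using profile_2P1_P2[of G] I path by (simp add: numeral_2_eq_2)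
    next
      case (2 s')
      have d: "spider d \<sqsubseteq> spider (replicate 1 1)" using path 2 by simp
      have "G \<sqsubseteq> forest ([2] # replicate (max 1 (s + 2)) [])"
        by (rule iso_forest_upper[OF I]) (simp add: path 2)
      moreover have "forest [[1], [], [], []] \<sqsubseteq> G" by (rule iso_forest_lower[OF I]) (simp add: path 2)
      ultimately show ?thesis using profile_sP1_P2 up[OF d refl] by blast
    next
      case 3 then show ?thesis using profile_2P1_P3[of G] I path by (simp add: numeral_2_eq_2)
    next
      case (4 s')
      have "spider [2] \<sqsubseteq> spider (replicate 2 1)" by code_simp
      then have d: "spider d \<sqsubseteq> spider (replicate 2 1)" using path 4 by (simp add: numeral_2_eq_2)
      have "G \<sqsubseteq> forest ([2] # replicate (max 2 (s + 2)) [])"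
        by (rule iso_forest_upper[OF I]) (simp add: path 4)
      moreover have "forest [[2], [], [], []] \<sqsubseteq> G" by (rule iso_forest_lower[OF I]) (simp add: path 4)
      ultimately show ?thesis using profile_sP1_P3 up[OF d refl] by blast
    next
      case (5 r')
      have "forest [[3], [], []] \<sqsubseteq> G" by (rule iso_forest_lower[OF I]) (simp add: path 5)
      then show ?thesis by (rule profile_2P1_P4)
    qed
  next
    case (star k)
    have "forest [[1, 1, 1], [], []] \<sqsubseteq> G" by (rule iso_forest_lower[OF I]) (simp add: star numeral_3_eq_3)
    moreover have "spider d \<sqsubseteq> spider (replicate (k + 3) 1)" by (simp only: star induced_sub_refl)
    ultimately show ?thesis using profile_S1k_sP1 up by blast
  qed (rule S211, (auto simp: legs_le_Cons_iff numeral_2_eq_2)[1])+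
qed

lemma normal_legs_cases_coarse [consumes 1, case_names P2 P3 star P4 P5 S211]:
  assumes "normal_legs d"
  obtains "d = [1]" | "d = [2]" | k where "d = replicate (k + 3) 1" | "d = [3]" | "legs_le [4] d" | "legs_le [2, 1, 1] d"
  using assms
proof (cases rule: normal_legs_cases)
  case (path r)
  consider "r = 0" | "r = 1" | "r = 2" | "3 \<le> r" by linarith
  then show ?thesis using path that(1,2,4,5) by cases auto
next
  case (star k) then show ?thesis by (rule that(3))
qed (rule that(6), (auto simp: legs_le_Cons_iff numeral_2_eq_2)[1])+

lemma forest_pair_mono:
  "spider a \<sqsubseteq> spider a' \<Longrightarrow> spider b \<sqsubseteq> spider b' \<Longrightarrow> forest (a # b # r) \<sqsubseteq> forest (a' # b' # r)"
  unfolding forest_Cons by (intro gunion_mono) auto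

text \<open>Beside P_2, a component above \<open>[4]\<close> gives 3P_2 and one above
  \<open>[2, 1, 1]\<close> gives 2P_1+2P_2. Stars and the paths up to P_4 are left.\<close>

lemma classify_P2_plus_component:
  assumes "normal_legs d" and I: "graph_iso G (forest (d # [1] # replicate s []))" and s: "s \<le> 1"
  shows "profile G"
proof -
  have sub: "forest (x # [1] # replicate s []) \<sqsubseteq> G" if "legs_le x d" for x
    by (rule iso_forest_lower[OF I]) (use that in simp)
  have s: "s = 0 \<or> s = 1" using s by linarith
  have large: ?thesis if "forest [[3], [1], []] \<sqsubseteq> G"
  proof -
    have "forest [[3], [], []] \<sqsubseteq> forest [[3], [1], []]" by code_simp
    then show ?thesis using that profile_2P1_P4 induced_sub_trans by blast
  qed
  from assms(1) show ?thesis
  proof (cases rule: normal_legs_cases_coarse)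
    case P2
    then show ?thesis using s I profile_2P2[of G] profile_P1_2P2[of G] by auto
  next
    case P3
    then show ?thesis using s I profile_P2_P3[of G] profile_P1_P2_P3[of G] by auto
  next
    case (star k)
    have low: "forest ([1, 1, 1] # [1] # replicate s []) \<sqsubseteq> G"
      by (rule sub) (simp add: star numeral_3_eq_3)
    show ?thesis
    proof (cases "s = 0")
      case True
      have "G \<sqsubseteq> forest [replicate (k + 3) 1, replicate (k + 3) 1]"
        by (rule iso_forest_upper[OF I]) (simp add: star True numeral_3_eq_3)
      then show ?thesis using profile_S1k_P2 low True by simp
    next
      case False
      then have s1: "s = 1" using s by blast
      \<comment> \<open>Cutting the long leg of a K_{1,t}^{++} at the centre leaves a star and P_2,
        which places the graph in the last family of (e).\<close>
      have "spider d \<oplus> spider [1] \<sqsubseteq> spider (3 # d)"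
        using spider_cut[of d 1] by (simp only: numeral_3_eq_3 One_nat_def)
      then have "forest [d, [1], []] \<sqsubseteq> forest [3 # d, []]"
        unfolding forest_Cons gunion_assoc[symmetric] by (intro gunion_mono induced_sub_refl)
      then have "G \<sqsubseteq> forest [3 # replicate (k + 3) 1, []]"
        using iso_transfer(3)[OF I] s1 star by simp
      then show ?thesis using profile_S1k_P2_P1 low s1 by simp
    qed
  next
    case P4
    have "s = 1 \<Longrightarrow> forest [[3], [1], []] \<sqsubseteq> G" by (rule iso_forest_lower[OF I]) (simp add: P4)
    then show ?thesis using s I profile_P2_P4[of G] large P4 by auto
  next
    case P5
    have "forest [[1], [1], [1]] \<sqsubseteq> forest [[4], [1]]" by code_simp
    moreover have "forest [[4], [1]] \<sqsubseteq> G"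
      by (rule iso_forest_lower[OF I]) (use P5 in simp)
    ultimately show ?thesis using profile_3P2 induced_sub_trans by blast
  next
    case S211
    have "forest [[1], [1], [], []] \<sqsubseteq> forest [[2, 1, 1], [1]]" by code_simp
    moreover have "forest [[2, 1, 1], [1]] \<sqsubseteq> G"
      by (rule iso_forest_lower[OF I]) (use S211 in \<open>simp del: One_nat_def\<close>)
    ultimately show ?thesis using profile_2P1_2P2 induced_sub_trans by blast
  qed
qed

text \<open>A component with edges other than P_2 contains P_3, and it lies in a star unless it
  contains P_4. An isolated vertex therefore yields P_1+2P_3, a P_4 yields 2P_1+P_4 with the two
  ends of the other P_3, and otherwise the graph lies in two equal stars.\<close>

lemma classify_two_large_components:
  assumes "normal_legs d" "normal_legs e" "d \<noteq> [1]" "e \<noteq> [1]"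
    and I: "graph_iso G (forest (d # e # replicate s []))" and s: "s \<le> 1"
  shows "profile G"
proof -
  have P3: "spider [2] \<sqsubseteq> spider c" if "normal_legs c" "c \<noteq> [1]" for c
    using that(1)
  proof (cases rule: normal_legs_cases_coarse)
    case (star k)
    have "spider [2] \<sqsubseteq> spider [1, 1]" by code_simp
    also have "\<dots> \<sqsubseteq> spider c" by (rule spider_sub_legs_le) (simp add: star numeral_3_eq_3)
    finally show ?thesis .
  qed (use that(2) in \<open>auto intro!: spider_sub_legs_le simp: legs_le_Cons_iff\<close>)
  have P4: "(\<exists>k. spider c \<sqsubseteq> spider (replicate k 1)) \<or> spider [3] \<sqsubseteq> spider c" if "normal_legs c" for c
    using that
  proof (cases rule: normal_legs_cases_coarse)
    case P2
    have "spider [1] \<sqsubseteq> spider (replicate 1 1)" by code_simp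
    then show ?thesis using P2 by blast
  next
    case P3
    have "spider [2] \<sqsubseteq> spider (replicate 2 1)" by code_simp
    then show ?thesis using P3 by blast
  next
    case (star k) then show ?thesis using induced_sub_refl by blast
  next
    case S211
    have "spider [3] \<sqsubseteq> spider [2, 1, 1]" by code_simp
    also have "\<dots> \<sqsubseteq> spider c" by (rule spider_sub_legs_le) (rule S211)
    finally show ?thesis ..
  qed (auto intro!: disjI2 spider_sub_legs_le simp: legs_le_Cons_iff)
  have low: "forest ([2] # [2] # replicate s []) \<sqsubseteq> G"
    using iso_transfer(2)[OF I] forest_pair_mono P3 assms by blast
  have s01: "s = 0 \<or> s = 1" using s by linarith
  have P4_P3: ?thesis if "forest [[3], [2]] \<sqsubseteq> G"
  proof -
    have "forest [[3], [], []] \<sqsubseteq> forest [[3], [2]]" by code_simp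
    then show ?thesis using that profile_2P1_P4 induced_sub_trans by blast
  qed
  show ?thesis
  proof (cases "s = 1")
    case True then show ?thesis using profile_P1_2P3 low by simp
  next
    case False
    then have s0: "s = 0" using s01 by blast
    then have I0: "graph_iso G (forest [d, e])" using I by simp
    show ?thesis
    proof (cases "spider [3] \<sqsubseteq> spider d \<or> spider [3] \<sqsubseteq> spider e")
      case True
      have "forest [[2], [3]] \<sqsubseteq> G \<Longrightarrow> forest [[3], [2]] \<sqsubseteq> G"
        using forest_perm[of "[[3], [2]]" "[[2], [3]]"] induced_sub_trans by (auto simp: add_mset_commute)
      then show ?thesis
        using True forest_pair_mono P3 assms iso_transfer(2)[OF I0] P4_P3 by metis
    next
      case False
      then obtain a b where ab: "spider d \<sqsubseteq> spider (replicate a 1)" "spider e \<sqsubseteq> spider (replicate b 1)"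
        using P4 assms(1,2) by blast
      have "spider (replicate a 1) \<sqsubseteq> spider (replicate (max a b) 1)"
        "spider (replicate b 1) \<sqsubseteq> spider (replicate (max a b) 1)" by (simp_all add: spider_sub_legs_le)
      then have "G \<sqsubseteq> forest [replicate (max a b) 1, replicate (max a b) 1]"
        using ab forest_pair_mono iso_transfer(3)[OF I0] induced_sub_trans by metis
      then show ?thesis using profile_S1a_S1b low s0 by simp
    qed
  qed
qed

lemma legs_le_one_normal: "normal_legs d \<Longrightarrow> legs_le [1] d"
  by (erule normal_legs_cases_coarse) (auto simp: legs_le_Cons_iff numeral_3_eq_3)

text \<open>Three components with edges contain 3P_2, and two of them together with two isolated
  vertices contain 2P_1+2P_2. This leaves the combinations treated by the classification
  lemmas.\<close>

theorem path_star_forest_profile: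
  assumes "path_star_forest G"
  shows "G \<sqsubseteq> P 4 \<or> graph_iso G (P 1 \<oplus> P 3) \<or> profile G"
proof -
  obtain ds s where I: "graph_iso G (forest (ds @ replicate s []))" and ds: "\<forall>d\<in>set ds. normal_legs d"
    using path_star_forest_normal_form assms by blast
  consider "ds = []" | d where "ds = [d]" | d e where "ds = [d, e]" | d e f r where "ds = d # e # f # r"
    by (metis neq_Nil_conv)
  then show ?thesis
  proof cases
    case 1 then show ?thesis using classify_edgeless[of G s] I by auto
  next
    case (2 d)
    consider "s = 0" | "s = 1" | s' where "s = s' + 2"
      by (metis add.commute One_nat_def add_2_eq_Suc not0_implies_Suc)
    then show ?thesis
      using classify_connected[of d G] classify_connected_plus_vertex[of d G] classify_connected_plus_isolated[of d G]
        I ds 2 by cases auto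
  next
    case (3 d e)
    show ?thesis
    proof (cases "s \<le> 1")
      case False
      then obtain s' where "s = Suc (Suc s')" by (metis One_nat_def le0 not_less_eq_eq not0_implies_Suc)
      moreover have "legs_le [1] d" "legs_le [1] e" using ds 3 legs_le_one_normal by auto
      ultimately have "forest [[1], [1], [], []] \<sqsubseteq> G"
        by (intro iso_forest_lower[OF I]) (simp add: 3 del: One_nat_def)
      then show ?thesis using profile_2P1_2P2 by blast
    next
      case True
      have swap: "forest (d # e # r) \<sqsubseteq> forest (e # d # r)" for d e r
        by (rule forest_perm) (simp add: add_mset_commute)
      then have "graph_iso (forest (d # e # replicate s [])) (forest (e # d # replicate s []))"
        by (simp add: graph_iso_iff_mutual)
      then have "graph_iso G (forest (e # d # replicate s []))"
        using I 3 graph_iso_trans by fastforce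
      then show ?thesis
        using classify_P2_plus_component[of d G s] classify_P2_plus_component[of e G s]
          classify_two_large_components[of d e G s] I ds 3 True by fastforce
    qed
  next
    case (4 d e f r)
    have "legs_le [1] d" "legs_le [1] e" "legs_le [1] f" using ds 4 legs_le_one_normal by auto
    then have "forest [[1], [1], [1]] \<sqsubseteq> G"
      by (intro iso_forest_lower[OF I]) (simp add: 4 del: One_nat_def)
    then show ?thesis using profile_3P2 by blast
  qed
qed

section \<open>Unresolved pairs lie in one of the six classes\<close>

text \<open>Conditions (b)-(h) and (k)-(p) for the pair \<open>(gcompl A, B)\<close>, rewritten so
  that only \<open>A\<close> and \<open>B\<close> occur: K_t becomes tP_1, C_4 becomes 2P_2, and
  paw, diamond and gem become P_1+P_3, 2P_1+P_2 and P_1+P_4. A bound depending on \<open>t\<close>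
  is demanded for all large \<open>t\<close>.\<close>

definition resolved :: "graph \<Rightarrow> graph \<Rightarrow> bool" where
  "resolved A B \<longleftrightarrow>
     (fits (\<lambda>t. star_graph t \<oplus> P 1) A \<and> fits (\<lambda>t. star_graph t \<oplus> P 1) B)
   \<or> (fits (\<lambda>t. gcopies t (P 1) \<oplus> P 3) A \<and> fits (\<lambda>t. gcopies t (P 1) \<oplus> P 3) B)
   \<or> (fits (\<lambda>t. gcopies t (P 1)) A \<and>
        (fits (\<lambda>t. gcopies 2 (star_graph t)) B \<or> fits star_plus B \<or> B \<sqsubseteq> P 5))
   \<or> (A \<sqsubseteq> P 1 \<oplus> P 3 \<and>
        (B \<sqsubseteq> P 2 \<oplus> P 4 \<or> B \<sqsubseteq> P 6 \<or> B \<sqsubseteq> S_graph 1 2 2 \<or> fits (\<lambda>t. star_pplus t \<oplus> P 1) B))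
   \<or> (A \<sqsubseteq> gcopies 2 (P 1) \<oplus> P 2 \<and> B \<sqsubseteq> P 1 \<oplus> gcopies 2 (P 2))
   \<or> (A \<sqsubseteq> P 1 \<oplus> P 4 \<and> (B \<sqsubseteq> P 1 \<oplus> P 4 \<or> B \<sqsubseteq> P 5))
   \<or> (A \<sqsubseteq> gcopies 2 (P 1) \<oplus> P 3 \<and> (B \<sqsubseteq> P 2 \<oplus> P 3 \<or> B \<sqsubseteq> P 5))
   \<or> (gcopies 3 (P 1) \<sqsubseteq> A \<and>
        (gcopies 2 (P 1) \<oplus> gcopies 2 (P 2) \<sqsubseteq> B \<or> P 1 \<oplus> gcopies 2 (P 3) \<sqsubseteq> B \<or>
         gcopies 2 (P 1) \<oplus> P 4 \<sqsubseteq> B \<or> gcopies 3 (P 2) \<sqsubseteq> B))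
   \<or> (gcopies 4 (P 1) \<sqsubseteq> A \<and>
        (star_pplus 4 \<sqsubseteq> B \<or> P 1 \<oplus> gcopies 2 (P 2) \<sqsubseteq> B \<or> P 1 \<oplus> P 4 \<sqsubseteq> B))
   \<or> (gcopies 5 (P 1) \<sqsubseteq> A \<and> star_pplus 3 \<sqsubseteq> B)
   \<or> (gcopies 2 (P 2) \<sqsubseteq> A \<and>
        (star_graph 3 \<sqsubseteq> B \<or> gcopies 3 (P 1) \<oplus> P 2 \<sqsubseteq> B \<or> gcopies 2 (P 2) \<sqsubseteq> B))
   \<or> (gcopies 2 (P 1) \<oplus> P 2 \<sqsubseteq> A \<and>
        (star_graph 3 \<sqsubseteq> B \<or> P 2 \<oplus> P 4 \<sqsubseteq> B \<or> gcopies 2 (P 3) \<sqsubseteq> B \<or> P 6 \<sqsubseteq> B))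
   \<or> (P 1 \<oplus> P 4 \<sqsubseteq> A \<and> P 1 \<oplus> gcopies 2 (P 2) \<sqsubseteq> B)"

definition open_pair :: "graph \<Rightarrow> graph \<Rightarrow> bool" where
  "open_pair A B \<longleftrightarrow>
     (graph_iso A (gcopies 3 (P 1)) \<and> (graph_iso B (P 7) \<or> graph_iso B (S_graph 1 2 3)))
   \<or> (graph_iso A (gcopies 4 (P 1)) \<and> graph_iso B (S_graph 1 1 3))
   \<or> (graph_iso A (gcopies 2 (P 1) \<oplus> P 2) \<and>
        (graph_iso B (P 1 \<oplus> P 2 \<oplus> P 3) \<or> graph_iso B (P 1 \<oplus> P 5)))
   \<or> (graph_iso A (P 1 \<oplus> P 4) \<and> graph_iso B (P 2 \<oplus> P 3))"

text \<open>All 31 times 31 combinations of rules are checked. The premises of the rules are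
  literally the atoms of \<open>resolved\<close> and \<open>open_pair\<close>, so propositional
  simplification settles each one. Both orders are offered because the conditions are not symmetric
  in \<open>A\<close> and \<open>B\<close>.\<close>

lemma profile_pair:
  assumes "profile A" "profile B"
  shows "resolved A B \<or> resolved B A \<or> open_pair A B \<or> open_pair B A"
  using assms(1) by cases (use assms(2) in \<open>cases; simp only: resolved_def open_pair_def simp_thms\<close>)+

section \<open>Complementation\<close>

lemma fst_gcompl [simp]: "fst (gcompl G) = fst G"
  by (simp add: gcompl_def)

lemma wf_gcompl: "wf_graph G \<Longrightarrow> wf_graph (gcompl G)"
  by (auto simp: wf_graph_def gcompl_def)

lemma gcompl_gcompl: "wf_graph G \<Longrightarrow> graph_iso (gcompl (gcompl G)) G"
  by (rule graph_iso_id) (auto simp: wf_graph_def gcompl_def)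

lemma gcompl_mono: assumes "F \<sqsubseteq> G" shows "gcompl F \<sqsubseteq> gcompl G"
proof -
  obtain f where f: "inj_on f {..<fst F}" "f ` {..<fst F} \<subseteq> {..<fst G}"
    "\<forall>u<fst F. \<forall>v<fst F. snd F u v \<longleftrightarrow> snd G (f u) (f v)" using assms unfolding induced_sub_def by blast
  have "snd (gcompl F) u v \<longleftrightarrow> snd (gcompl G) (f u) (f v)" if "u < fst F" "v < fst F" for u v
    using f(3) that inj_on_eq_iff[OF f(1), of u v] by (simp add: gcompl_def)
  then show ?thesis unfolding induced_sub_def fst_gcompl using f(1,2) by blast
qed

lemma gcompl_iso: "graph_iso F G \<Longrightarrow> graph_iso (gcompl F) (gcompl G)"
  by (simp add: graph_iso_iff_mutual gcompl_mono)

lemma wf_graph_iso: assumes "graph_iso F G" "wf_graph F" shows "wf_graph G"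
proof -
  obtain f where f: "bij_betw f {..<fst G} {..<fst F}"
    "\<forall>u<fst G. \<forall>v<fst G. snd G u v \<longleftrightarrow> snd F (f u) (f v)"
    using graph_iso_sym[OF assms(1)] unfolding graph_iso_def by blast
  have "f u < fst F" if "u < fst G" for u using bij_betwE[OF f(1)] that by auto
  then show ?thesis using assms(2) f(2) by (simp add: wf_graph_def)
qed

lemma gcopies_P1: "fst (gcopies t (P 1)) = t" "u < t \<Longrightarrow> v < t \<Longrightarrow> \<not> snd (gcopies t (P 1)) u v"
proof (induction t arbitrary: u v)
  case (Suc t)
  { case 1 then show ?case using Suc by (simp add: gunion_def path_graph_def) }
  { case 2 then show ?case using Suc(2)[of "u - 1" "v - 1"] by (auto simp: gunion_def path_graph_def) }
qed (auto simp: null_graph_def)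

lemma gcompl_gcopies_P1: "graph_iso (gcompl (gcopies t (P 1))) (K t)"
  by (rule graph_iso_id) (use gcopies_P1 in \<open>auto simp: gcompl_def complete_graph_def\<close>)

lemma sub_gcompl: assumes "graph_iso (gcompl X) Y" "X \<sqsubseteq> A" shows "Y \<sqsubseteq> gcompl A"
  using assms gcompl_mono graph_iso_iff_mutual induced_sub_trans by blast

lemma gcompl_sub: assumes "graph_iso (gcompl X) Y" "A \<sqsubseteq> X" shows "gcompl A \<sqsubseteq> Y"
  using assms gcompl_mono graph_iso_iff_mutual induced_sub_trans by blast

lemma fits_common: "fits F A \<Longrightarrow> fits H B \<Longrightarrow> \<exists>t\<ge>1. A \<sqsubseteq> F t \<and> B \<sqsubseteq> H t"
  unfolding fits_def by (metis linorder_le_cases order_trans)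

lemma fitsD: "fits F A \<Longrightarrow> \<exists>t\<ge>1. A \<sqsubseteq> F t"
  unfolding fits_def by (metis linorder_le_cases)

text \<open>Complementing preserves the direction of containment, so each clause about
  \<open>A\<close> turns into the clause about \<open>gcompl A\<close>. In (b) and (c) the
  complement of the first graph is a double complement of \<open>A\<close>, which well-formedness
  allows to be removed.\<close>

lemma resolved_known:
  assumes "wf_graph A" "resolved A B"
  shows "known_condition (gcompl A) B"
proof -
  have cc: "A \<sqsubseteq> X \<Longrightarrow> gcompl (gcompl A) \<sqsubseteq> X" for X
    using iso_transfer(3)[OF gcompl_gcompl[OF assms(1)]] .
  have cK: "A \<sqsubseteq> gcopies t (P 1) \<Longrightarrow> gcompl A \<sqsubseteq> K t" for t using gcompl_sub[OF gcompl_gcopies_P1] .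
  have Kc: "gcopies t (P 1) \<sqsubseteq> A \<Longrightarrow> K t \<sqsubseteq> gcompl A" for t using sub_gcompl[OF gcompl_gcopies_P1] .
  have "graph_iso (gcompl (gcopies 2 (P 2))) (cycle_graph 4)" by code_simp
  then have C4: "gcopies 2 (P 2) \<sqsubseteq> A \<Longrightarrow> cycle_graph 4 \<sqsubseteq> gcompl A" by (rule sub_gcompl)
  \<comment> \<open>The clauses with a parameter are separated, since each needs its own witness
    \<open>t\<close>; those without one are bundled for propositional reasoning.\<close>
  consider
      "fits (\<lambda>t. star_graph t \<oplus> P 1) A" "fits (\<lambda>t. star_graph t \<oplus> P 1) B"
    | "fits (\<lambda>t. gcopies t (P 1) \<oplus> P 3) A" "fits (\<lambda>t. gcopies t (P 1) \<oplus> P 3) B"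
    | "fits (\<lambda>t. gcopies t (P 1)) A" "fits (\<lambda>t. gcopies 2 (star_graph t)) B"
    | "fits (\<lambda>t. gcopies t (P 1)) A" "fits star_plus B"
    | "fits (\<lambda>t. gcopies t (P 1)) A" "B \<sqsubseteq> P 5"
    | "A \<sqsubseteq> P 1 \<oplus> P 3" "fits (\<lambda>t. star_pplus t \<oplus> P 1) B"
    | "A \<sqsubseteq> P 1 \<oplus> P 3" "B \<sqsubseteq> P 2 \<oplus> P 4 \<or> B \<sqsubseteq> P 6 \<or> B \<sqsubseteq> S_graph 1 2 2"
    | "A \<sqsubseteq> gcopies 2 (P 1) \<oplus> P 2 \<and> B \<sqsubseteq> P 1 \<oplus> gcopies 2 (P 2)
        \<or> A \<sqsubseteq> P 1 \<oplus> P 4 \<and> (B \<sqsubseteq> P 1 \<oplus> P 4 \<or> B \<sqsubseteq> P 5)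
        \<or> A \<sqsubseteq> gcopies 2 (P 1) \<oplus> P 3 \<and> (B \<sqsubseteq> P 2 \<oplus> P 3 \<or> B \<sqsubseteq> P 5)"
    | "gcopies 3 (P 1) \<sqsubseteq> A \<and>
          (gcopies 2 (P 1) \<oplus> gcopies 2 (P 2) \<sqsubseteq> B \<or> P 1 \<oplus> gcopies 2 (P 3) \<sqsubseteq> B \<or>
           gcopies 2 (P 1) \<oplus> P 4 \<sqsubseteq> B \<or> gcopies 3 (P 2) \<sqsubseteq> B)
        \<or> gcopies 4 (P 1) \<sqsubseteq> A \<and>
          (star_pplus 4 \<sqsubseteq> B \<or> P 1 \<oplus> gcopies 2 (P 2) \<sqsubseteq> B \<or> P 1 \<oplus> P 4 \<sqsubseteq> B)
        \<or> gcopies 5 (P 1) \<sqsubseteq> A \<and> star_pplus 3 \<sqsubseteq> B"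
    | "gcopies 2 (P 2) \<sqsubseteq> A \<and>
        (star_graph 3 \<sqsubseteq> B \<or> gcopies 3 (P 1) \<oplus> P 2 \<sqsubseteq> B \<or> gcopies 2 (P 2) \<sqsubseteq> B)"
    | "gcopies 2 (P 1) \<oplus> P 2 \<sqsubseteq> A \<and>
        (star_graph 3 \<sqsubseteq> B \<or> P 2 \<oplus> P 4 \<sqsubseteq> B \<or> gcopies 2 (P 3) \<sqsubseteq> B \<or> P 6 \<sqsubseteq> B)
        \<or> P 1 \<oplus> P 4 \<sqsubseteq> A \<and> P 1 \<oplus> gcopies 2 (P 2) \<sqsubseteq> B"
    using assms(2) unfolding resolved_def by argo
  then show ?thesis
  proof cases
    case 1
    then obtain t where t: "t \<ge> 1" "A \<sqsubseteq> star_graph t \<oplus> P 1" "B \<sqsubseteq> star_graph t \<oplus> P 1" using fits_common by blast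
    have "\<exists>t\<ge>1. gcompl (gcompl A) \<sqsubseteq> star_graph t \<oplus> P 1 \<and> B \<sqsubseteq> star_graph t \<oplus> P 1"
      by (rule exI[of _ t]) (simp only: t cc simp_thms)
    then show ?thesis by (simp only: known_condition_def simp_thms)
  next
    case 2
    then obtain t where t: "t \<ge> 1" "A \<sqsubseteq> gcopies t (P 1) \<oplus> P 3" "B \<sqsubseteq> gcopies t (P 1) \<oplus> P 3" using fits_common by blast
    have "\<exists>t\<ge>1. gcompl (gcompl A) \<sqsubseteq> gcopies t (P 1) \<oplus> P 3 \<and> B \<sqsubseteq> gcopies t (P 1) \<oplus> P 3"
      by (rule exI[of _ t]) (simp only: t cc simp_thms)
    then show ?thesis by (simp only: known_condition_def simp_thms)
  next
    case 3
    then obtain t where t: "t \<ge> 1" "A \<sqsubseteq> gcopies t (P 1)" "B \<sqsubseteq> gcopies 2 (star_graph t)" using fits_common by blast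
    have "\<exists>t\<ge>1. gcompl A \<sqsubseteq> K t \<and> (B \<sqsubseteq> gcopies 2 (star_graph t) \<or> B \<sqsubseteq> star_plus t \<or> B \<sqsubseteq> P 5)"
      by (rule exI[of _ t]) (simp only: t cK simp_thms)
    then show ?thesis by (simp only: known_condition_def simp_thms)
  next
    case 4
    then obtain t where t: "t \<ge> 1" "A \<sqsubseteq> gcopies t (P 1)" "B \<sqsubseteq> star_plus t" using fits_common by blast
    have "\<exists>t\<ge>1. gcompl A \<sqsubseteq> K t \<and> (B \<sqsubseteq> gcopies 2 (star_graph t) \<or> B \<sqsubseteq> star_plus t \<or> B \<sqsubseteq> P 5)"
      by (rule exI[of _ t]) (simp only: t cK simp_thms)
    then show ?thesis by (simp only: known_condition_def simp_thms)
  next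
    case 5
    then obtain t where t: "t \<ge> 1" "A \<sqsubseteq> gcopies t (P 1)" "B \<sqsubseteq> P 5" using fitsD by blast
    have "\<exists>t\<ge>1. gcompl A \<sqsubseteq> K t \<and> (B \<sqsubseteq> gcopies 2 (star_graph t) \<or> B \<sqsubseteq> star_plus t \<or> B \<sqsubseteq> P 5)"
      by (rule exI[of _ t]) (simp only: t cK simp_thms)
    then show ?thesis by (simp only: known_condition_def simp_thms)
  next
    case 6
    then have "gcompl A \<sqsubseteq> paw" "\<exists>t\<ge>1. B \<sqsubseteq> star_pplus t \<oplus> P 1"
      using gcompl_mono[OF 6(1)] fitsD[OF 6(2)] by (simp_all only: paw_def)
    then show ?thesis by (simp only: known_condition_def simp_thms)
  next
    case 7
    then have "gcompl A \<sqsubseteq> paw" using gcompl_mono[OF 7(1)] by (simp only: paw_def)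
    then show ?thesis using 7(2) unfolding known_condition_def by argo
  next
    case 8
    then show ?thesis
      using gcompl_mono[of A "gcopies 2 (P 1) \<oplus> P 2"] gcompl_mono[of A "P 1 \<oplus> P 4"]
        gcompl_mono[of A "gcopies 2 (P 1) \<oplus> P 3"]
      unfolding known_condition_def diamond_def gem_def by argo
  next
    case 9 then show ?thesis using Kc[of 3] Kc[of 4] Kc[of 5] unfolding known_condition_def by argo
  next
    case 10 then show ?thesis using C4 unfolding known_condition_def by argo
  next
    case 11
    then show ?thesis
      using gcompl_mono[of "gcopies 2 (P 1) \<oplus> P 2" A] gcompl_mono[of "P 1 \<oplus> P 4" A]
      unfolding known_condition_def diamond_def gem_def by argo
  qed
qed

text \<open>The largest vertex of a cycle would have two smaller neighbours.\<close>

definition unique_parents :: "graph \<Rightarrow> bool" where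
  "unique_parents G \<longleftrightarrow> (\<forall>u v w. u < w \<longrightarrow> v < w \<longrightarrow> snd G u w \<longrightarrow> snd G v w \<longrightarrow> u = v)"

text \<open>Vertex numbers grow along each leg away from the centre. In the newest leg, vertex
  \<open>n\<close> has only 0 as a smaller neighbour, and a later vertex has only its
  predecessor.\<close>

lemma unique_parents_spider: "unique_parents (spider ls)"
proof (induction ls)
  case (Cons l ls)
  define n where "n = fst (spider ls)"
  have n: "0 < n" by (simp add: n_def spider_pos)
  show ?case unfolding unique_parents_def
  proof (intro allI impI)
    fix u v w assume *: "u < w" "v < w" "snd (spider (l # ls)) u w" "snd (spider (l # ls)) v w"
    have "snd (spider ls) x w \<and> w < n \<or> w = n \<and> x = 0 \<or> n < w \<and> x + 1 = w" if "x < w" "snd (spider (l # ls)) x w" for x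
      using that spider_adj_less[of ls x w] n
      unfolding spider_Cons_adj leg_edge_def n_def[symmetric] by auto
    from this[OF *(1,3)] this[OF *(2,4)] show "u = v"
      using Cons *(1,2) by (auto simp: unique_parents_def)
  qed
qed (simp add: unique_parents_def)

lemma unique_parents_forest: "unique_parents (forest lss)"
proof (induction lss)
  case Nil then show ?case by (simp add: forest_Nil null_graph_def unique_parents_def)
next
  case (Cons c lss)
  show ?case unfolding unique_parents_def
  proof (intro allI impI)
    fix u v w assume *: "u < w" "v < w" "snd (forest (c # lss)) u w" "snd (forest (c # lss)) v w"
    show "u = v"
    proof (cases "w < fst (spider c)")
      case True then show ?thesis
        using * unique_parents_spider[of c] by (auto simp: forest_Cons gunion_def unique_parents_def)
    next
      case False
      let ?n = "fst (spider c)"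
      have "?n \<le> u" "?n \<le> v" "snd (forest lss) (u - ?n) (w - ?n)" "snd (forest lss) (v - ?n) (w - ?n)"
        using * False by (auto simp: forest_Cons gunion_def)
      moreover from this have "u - ?n < w - ?n" "v - ?n < w - ?n" using *(1,2) by auto
      ultimately have "u - ?n = v - ?n" using Cons unfolding unique_parents_def by blast
      then show ?thesis using \<open>?n \<le> u\<close> \<open>?n \<le> v\<close> by linarith
    qed
  qed
qed

lemma no_cycle_forest:
  assumes "path_star_forest G" shows "\<not> K 3 \<sqsubseteq> G" "\<not> cycle_graph 4 \<sqsubseteq> G"
proof -
  obtain lss where I: "graph_iso G (forest lss)"
    using assms unfolding path_star_forest_def forest_def by blast
  have parent: "u = v" if "snd (forest lss) u w" "snd (forest lss) v w" "u < w" "v < w" for u v w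
    using that unique_parents_forest[of lss] unfolding unique_parents_def by blast
  show "\<not> K 3 \<sqsubseteq> G"
  proof
    assume "K 3 \<sqsubseteq> G"
    then have "K 3 \<sqsubseteq> forest lss" using I graph_iso_iff_mutual induced_sub_trans by blast
    then obtain f where f: "inj_on f {..<3::nat}" "\<forall>u<3. \<forall>v<3. u \<noteq> v \<longleftrightarrow> snd (forest lss) (f u) (f v)"
      unfolding induced_sub_def complete_graph_def by auto
    have ne: "f 0 \<noteq> f 1" "f 0 \<noteq> f 2" "f 1 \<noteq> f 2" by (simp_all add: inj_on_eq_iff[OF f(1)])
    have e: "snd (forest lss) (f u) (f v)" if "u < 3" "v < 3" "u \<noteq> v" for u v using f(2) that by blast
    consider "f 0 < f 2" "f 1 < f 2" | "f 0 < f 1" "f 2 < f 1" | "f 1 < f 0" "f 2 < f 0" using ne by linarith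
    then show False
      using parent[of "f 0" "f 2" "f 1"] parent[of "f 0" "f 1" "f 2"] parent[of "f 1" "f 0" "f 2"]
        e[of 0 1] e[of 0 2] e[of 1 2] e[of 1 0] e[of 2 0] e[of 2 1] ne by cases auto
  qed
  show "\<not> cycle_graph 4 \<sqsubseteq> G"
  proof
    assume "cycle_graph 4 \<sqsubseteq> G"
    then have "cycle_graph 4 \<sqsubseteq> forest lss" using I graph_iso_iff_mutual induced_sub_trans by blast
    then obtain f where f: "inj_on f {..<4::nat}"
      "\<forall>u<4. \<forall>v<4. snd (cycle_graph 4) u v \<longleftrightarrow> snd (forest lss) (f u) (f v)"
      unfolding induced_sub_def by (auto simp: cycle_graph_def)
    have ne: "f 0 \<noteq> f 1" "f 0 \<noteq> f 2" "f 0 \<noteq> f 3" "f 1 \<noteq> f 2" "f 1 \<noteq> f 3" "f 2 \<noteq> f 3"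
      by (simp_all add: inj_on_eq_iff[OF f(1)])
    have e: "snd (forest lss) (f u) (f v)" if "u < 4" "v < 4" "snd (cycle_graph 4) u v" for u v
      using f(2) that by blast
    have adj: "snd (cycle_graph 4) 0 1" "snd (cycle_graph 4) 2 1" "snd (cycle_graph 4) 1 2" "snd (cycle_graph 4) 3 2"
      "snd (cycle_graph 4) 2 3" "snd (cycle_graph 4) 0 3" "snd (cycle_graph 4) 1 0" "snd (cycle_graph 4) 3 0"
      by (auto simp: cycle_graph_def)
    \<comment> \<open>The vertex with the largest image exceeds both its neighbours on the cycle,
      which are distinct; this contradicts \<open>parent\<close>.\<close>
    consider "f 1 < f 0" "f 3 < f 0" | "f 0 < f 1" "f 2 < f 1" | "f 1 < f 2" "f 3 < f 2" | "f 0 < f 3" "f 2 < f 3"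
      using ne by linarith
    then show False
      using parent[of "f 1" "f 0" "f 3"] parent[of "f 0" "f 1" "f 2"] parent[of "f 1" "f 2" "f 3"] parent[of "f 0" "f 3" "f 2"]
        e[of 0 1] e[of 2 1] e[of 1 2] e[of 3 2] e[of 2 3] e[of 0 3] e[of 1 0] e[of 3 0] adj ne by cases auto
  qed
qed

text \<open>A forest has no K_3 or C_4, so a graph whose complement is a forest has no 3P_1 or 2P_2.
  Every profile, and P_1+P_3 as well, contains one of these two, possibly through K_{1,3} or
  4P_1.\<close>

lemma path_star_forest_and_complement:
  assumes "path_star_forest G" "path_star_forest (gcompl G)" shows "G \<sqsubseteq> P 4"
proof -
  have "graph_iso (gcompl (gcopies 2 (P 2))) (cycle_graph 4)" by code_simp
  then have no: "\<not> gcopies 3 (P 1) \<sqsubseteq> G" "\<not> gcopies 2 (P 2) \<sqsubseteq> G"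
    using no_cycle_forest[OF assms(2)] sub_gcompl gcompl_gcopies_P1 by blast+
  have "gcopies 3 (P 1) \<sqsubseteq> star_graph 3" "gcopies 3 (P 1) \<sqsubseteq> gcopies 4 (P 1)" "gcopies 3 (P 1) \<sqsubseteq> P 1 \<oplus> P 3"
    by code_simp+
  then have no': "\<not> star_graph 3 \<sqsubseteq> G" "\<not> gcopies 4 (P 1) \<sqsubseteq> G" "\<not> graph_iso G (P 1 \<oplus> P 3)"
    using no(1) induced_sub_trans graph_iso_iff_mutual by blast+
  have "\<not> profile G"
  proof
    assume "profile G"
    then show False using no no'(1,2) by cases (simp_all only: simp_thms)
  qed
  then show ?thesis using path_star_forest_profile[OF assms(1)] no'(3) by blast
qed

section \<open>Equivalence of pairs\<close>

lemma pair_equiv_refl [simp]: "pair_equiv p p"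
  by (simp add: pair_equiv_def)

lemma pair_equiv_trans [trans]: "pair_equiv p q \<Longrightarrow> pair_equiv q r \<Longrightarrow> pair_equiv p r"
  by (simp add: pair_equiv_def)

lemma pair_equiv_step: "equiv_step p q \<Longrightarrow> pair_equiv p q"
  by (simp add: pair_equiv_def)

lemma pair_equiv_iso: "graph_iso A A' \<Longrightarrow> graph_iso B B' \<Longrightarrow> pair_equiv (A, B) (A', B')"
  by (intro pair_equiv_step equiv_step.iso)

text \<open>In the form \<open>(gcompl A, B)\<close>, complementing and swapping amounts to
  exchanging the roles of \<open>A\<close> and \<open>B\<close>.\<close>

lemma pair_equiv_co_swap:
  assumes "wf_graph A" shows "pair_equiv (gcompl A, B) (gcompl B, A)"
proof -
  have "pair_equiv (gcompl A, B) (gcompl (gcompl A), gcompl B)" by (intro pair_equiv_step equiv_step.compl)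
  also have "pair_equiv \<dots> (gcompl B, gcompl (gcompl A))" by (intro pair_equiv_step equiv_step.swap)
  also have "pair_equiv \<dots> (gcompl B, A)" by (intro pair_equiv_iso gcompl_gcompl assms graph_iso_refl)
  finally show ?thesis .
qed

definition six_classes :: "graph \<times> graph \<Rightarrow> bool" where
  "six_classes p \<longleftrightarrow> pair_equiv p (K 3, P 7) \<or> pair_equiv p (K 3, S_graph 1 2 3)
    \<or> pair_equiv p (K 4, S_graph 1 1 3) \<or> pair_equiv p (diamond, P 1 \<oplus> P 2 \<oplus> P 3)
    \<or> pair_equiv p (diamond, P 1 \<oplus> P 5) \<or> pair_equiv p (gem, P 2 \<oplus> P 3)"

definition reaches_known :: "graph \<times> graph \<Rightarrow> bool" where
  "reaches_known p \<longleftrightarrow> (\<exists>H3 H4. wf_graph H3 \<and> wf_graph H4 \<and> pair_equiv p (H3, H4) \<and> known_condition H3 H4)"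

lemma six_classes_trans: "pair_equiv p q \<Longrightarrow> six_classes q \<Longrightarrow> six_classes p"
  unfolding six_classes_def using pair_equiv_trans by blast

lemma reaches_known_trans: "pair_equiv p q \<Longrightarrow> reaches_known q \<Longrightarrow> reaches_known p"
  unfolding reaches_known_def using pair_equiv_trans by blast

lemma open_pair_six: "open_pair A B \<Longrightarrow> six_classes (gcompl A, B)"
proof -
  assume o: "open_pair A B"
  have K: "graph_iso A (gcopies t (P 1)) \<Longrightarrow> graph_iso (gcompl A) (K t)" for t
    using gcompl_iso gcompl_gcopies_P1 graph_iso_trans by blast
  have "graph_iso A (gcopies 2 (P 1) \<oplus> P 2) \<Longrightarrow> graph_iso (gcompl A) diamond"
    "graph_iso A (P 1 \<oplus> P 4) \<Longrightarrow> graph_iso (gcompl A) gem"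
    unfolding diamond_def gem_def by (rule gcompl_iso, assumption)+
  then show ?thesis using o K[of 3] K[of 4] pair_equiv_iso unfolding open_pair_def six_classes_def by blast
qed

lemma replace_P1_P3:
  assumes "graph_iso A (P 1 \<oplus> P 3)" shows "pair_equiv (gcompl A, B) (gcompl (gcopies 3 (P 1)), B)"
proof -
  have "graph_iso (gcompl A) paw" unfolding paw_def using assms by (rule gcompl_iso)
  then show ?thesis using gcompl_gcopies_P1 by (intro pair_equiv_step equiv_step.paw_k3)
qed

lemma P4_known: "A \<sqsubseteq> P 4 \<Longrightarrow> known_condition (gcompl A) B" "B \<sqsubseteq> P 4 \<Longrightarrow> known_condition A B" "A \<sqsubseteq> P 4 \<Longrightarrow> known_condition A B"
proof -
  have "graph_iso (gcompl (P 4)) (P 4)" by code_simp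
  then show "A \<sqsubseteq> P 4 \<Longrightarrow> known_condition (gcompl A) B"
    using gcompl_sub by (simp add: known_condition_def)
qed (simp_all add: known_condition_def)

lemma profile_pair_outcome:
  assumes "profile A" "profile B" "wf_graph A" "wf_graph B"
  shows "reaches_known (gcompl A, B) \<or> six_classes (gcompl A, B)"
proof -
  have known: "reaches_known (gcompl A, B)" if "wf_graph A" "wf_graph B" "resolved A B" for A B
    unfolding reaches_known_def using that resolved_known[of A B] wf_gcompl[of A] pair_equiv_refl by blast
  note swap = pair_equiv_co_swap[OF assms(3), of B]
  from profile_pair[OF assms(1,2)] show ?thesis
    using known[OF assms(3,4)] known[OF assms(4,3)] reaches_known_trans[OF swap]
      open_pair_six[of A B] open_pair_six[of B A] six_classes_trans[OF swap] by blast
qed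

text \<open>P_1+P_3 has no profile and is traded for 3P_1, whose complement is the triangle. The
  equivalence is stated for all partners, so that both forests of a pair can be normalised in
  turn.\<close>

lemma normalise_P1_P3:
  assumes "path_star_forest A" "wf_graph A" "\<not> A \<sqsubseteq> P 4"
  obtains A' where "profile A'" "wf_graph A'" "\<And>B. pair_equiv (gcompl A, B) (gcompl A', B)"
proof (cases "graph_iso A (P 1 \<oplus> P 3)")
  case True
  have "graph_iso (gcopies 3 (P 1)) (forest [[], [], []])" by code_simp
  then have "profile (gcopies 3 (P 1))" by (rule profile_3P1)
  moreover have "wf_graph (gcopies 3 (P 1))" unfolding wf_graph_def gcopies_P1(1) using gcopies_P1(2) by blast
  ultimately show ?thesis using replace_P1_P3[OF True] by (rule that)
next
  case False
  then show ?thesis using that path_star_forest_profile assms pair_equiv_refl by blast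
qed

lemma co_forest_forest_pair:
  assumes wf: "wf_graph A" "wf_graph B" and psf: "path_star_forest A" "path_star_forest B"
  shows "reaches_known (gcompl A, B) \<or> six_classes (gcompl A, B)"
proof (cases "A \<sqsubseteq> P 4 \<or> B \<sqsubseteq> P 4")
  case True
  then have "known_condition (gcompl A) B" using P4_known by blast
  then show ?thesis unfolding reaches_known_def using wf wf_gcompl pair_equiv_refl by blast
next
  case False
  obtain A' where A': "profile A'" "wf_graph A'" "\<And>B. pair_equiv (gcompl A, B) (gcompl A', B)"
    using normalise_P1_P3[OF psf(1) wf(1)] False by blast
  obtain B' where B': "profile B'" "wf_graph B'" "\<And>A. pair_equiv (gcompl B, A) (gcompl B', A)"
    using normalise_P1_P3[OF psf(2) wf(2)] False by blast
  \<comment> \<open>Paw and triangle are exchanged in the first coordinate only, so the second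
    forest is brought there and back by \<open>pair_equiv_co_swap\<close>.\<close>
  have "pair_equiv (gcompl A, B) (gcompl A', B)" by (rule A'(3))
  also have "pair_equiv \<dots> (gcompl B, A')" by (rule pair_equiv_co_swap[OF A'(2)])
  also have "pair_equiv \<dots> (gcompl B', A')" by (rule B'(3))
  also have "pair_equiv \<dots> (gcompl A', B')" by (rule pair_equiv_co_swap[OF B'(2)])
  finally show ?thesis
    using profile_pair_outcome[OF A'(1) B'(1) A'(2) B'(2)] reaches_known_trans six_classes_trans by blast
qed

theorem unknown_imp_six_classes:
  assumes wf: "wf_graph H1" "wf_graph H2" and unknown: "\<not> reaches_known (H1, H2)"
  shows "six_classes (H1, H2)"
proof -
  have "\<not> known_condition H1 H2" using wf unknown pair_equiv_refl unfolding reaches_known_def by blast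
  then have no: "\<not> H1 \<sqsubseteq> P 4" "\<not> H2 \<sqsubseteq> P 4" "path_star_forest H1 \<or> path_star_forest H2"
    "path_star_forest (gcompl H1) \<or> path_star_forest (gcompl H2)"
    unfolding known_condition_def by argo+
  then consider "path_star_forest (gcompl H1)" "path_star_forest H2" | "path_star_forest (gcompl H2)" "path_star_forest H1"
    using path_star_forest_and_complement by blast
  then show ?thesis
  proof cases
    case 1
    have "pair_equiv (H1, H2) (gcompl (gcompl H1), H2)"
      by (intro pair_equiv_iso graph_iso_sym[OF gcompl_gcompl] wf graph_iso_refl)
    then show ?thesis
      using co_forest_forest_pair[OF wf_gcompl[OF wf(1)] wf(2) 1] unknown reaches_known_trans six_classes_trans by blast
  next
    case 2
    have "pair_equiv (H1, H2) (H2, H1)" by (intro pair_equiv_step equiv_step.swap)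
    also have "pair_equiv \<dots> (gcompl (gcompl H2), H1)"
      by (intro pair_equiv_iso graph_iso_sym[OF gcompl_gcompl] wf graph_iso_refl)
    finally show ?thesis
      using co_forest_forest_pair[OF wf_gcompl[OF wf(2)] wf(1) 2] unknown reaches_known_trans six_classes_trans by blast
  qed
qed

section \<open>The six classes are unresolved\<close>

text \<open>A complementation step is undone by a second one only up to isomorphism, and only for
  loopless graphs. Well-formedness is therefore carried along the induction.\<close>

lemma pair_equiv_sym:
  assumes "pair_equiv p q" "wf_graph (fst p)" "wf_graph (snd p)"
  shows "pair_equiv q p \<and> wf_graph (fst q) \<and> wf_graph (snd q)"
  using assms(1)[unfolded pair_equiv_def]
proof (induction rule: rtranclp_induct)
  case base then show ?case using assms by simp
next
  case (step q r)
  have "pair_equiv r q \<and> wf_graph (fst r) \<and> wf_graph (snd r)"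
    using step.hyps(2)
  proof cases
    case (swap A B)
    then show ?thesis using step.IH by (auto intro: pair_equiv_step equiv_step.swap)
  next
    case (compl A B)
    have "pair_equiv (gcompl A, gcompl B) (gcompl (gcompl A), gcompl (gcompl B))"
      by (intro pair_equiv_step equiv_step.compl)
    also have "pair_equiv \<dots> (A, B)"
      by (intro pair_equiv_iso gcompl_gcompl) (use step.IH compl in auto)
    finally show ?thesis using compl step.IH wf_gcompl by auto
  next
    case (iso A A' B B')
    then show ?thesis using step.IH wf_graph_iso by (auto intro: pair_equiv_iso graph_iso_sym)
  next
    case (k3_paw A A' B)
    have "wf_graph paw"
      by (auto simp: paw_def wf_graph_def gcompl_def gunion_def path_graph_def)
    then have "wf_graph A'" by (rule wf_graph_iso[OF graph_iso_sym[OF k3_paw(4)]])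
    moreover have "pair_equiv (A', B) (A, B)" by (intro pair_equiv_step equiv_step.paw_k3 k3_paw(3,4))
    ultimately show ?thesis using k3_paw(1,2) step.IH by simp
  next
    case (paw_k3 A A' B)
    have "wf_graph (K 3)" by (auto simp: wf_graph_def complete_graph_def)
    then have "wf_graph A'" by (rule wf_graph_iso[OF graph_iso_sym[OF paw_k3(4)]])
    moreover have "pair_equiv (A', B) (A, B)" by (intro pair_equiv_step equiv_step.k3_paw paw_k3(3,4))
    ultimately show ?thesis using paw_k3(1,2) step.IH by simp
  qed
  then show ?case using step.IH pair_equiv_trans by blast
qed

text \<open>Decidable necessary conditions for being an induced subgraph of a member of one of the infinite
  families. The index \<^term>\<open>fst G\<close>, which is not a vertex of \<open>G\<close>, stands for a centre outside the image.\<close>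

definition star_cover :: "graph \<Rightarrow> bool" where
  "star_cover G \<longleftrightarrow> (\<exists>c\<in>set [0..<Suc (fst G)]. \<forall>u\<in>set [0..<fst G]. \<forall>v\<in>set [0..<fst G].
     snd G u v \<longrightarrow> u = c \<or> v = c)"

definition cover2 :: "graph \<Rightarrow> bool" where
  "cover2 G \<longleftrightarrow> (\<exists>c\<in>set [0..<Suc (fst G)]. \<exists>d\<in>set [0..<Suc (fst G)]. \<forall>u\<in>set [0..<fst G]. \<forall>v\<in>set [0..<fst G].
     snd G u v \<longrightarrow> u = c \<or> v = c \<or> u = d \<or> v = d)"

text \<open>A cover of the edges by two vertices would be too weak: S_{1,1,3} has one, formed by its
  centre and the middle of its long leg. Those two have a common neighbour, which centres of
  different components cannot have.\<close>

definition two_stars_like :: "graph \<Rightarrow> bool" where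
  "two_stars_like G \<longleftrightarrow> (\<exists>c\<in>set [0..<Suc (fst G)]. \<exists>d\<in>set [0..<Suc (fst G)]. \<forall>u\<in>set [0..<fst G]. \<forall>v\<in>set [0..<fst G].
     snd G u v \<longrightarrow> (u = c \<or> v = c \<or> u = d \<or> v = d) \<and> (\<forall>w\<in>set [0..<fst G]. \<not> (u = c \<and> w = d \<and> snd G v w)))"

definition star_plus_like :: "graph \<Rightarrow> bool" where
  "star_plus_like G \<longleftrightarrow> (\<exists>c\<in>set [0..<Suc (fst G)]. \<exists>d\<in>set [0..<Suc (fst G)]. \<exists>e\<in>set [0..<Suc (fst G)].
     \<forall>u\<in>set [0..<fst G]. \<forall>v\<in>set [0..<fst G].
     snd G u v \<longrightarrow> u = c \<or> v = c \<or> (u = d \<and> v = e) \<or> (u = e \<and> v = d))"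

definition complete_like :: "graph \<Rightarrow> bool" where
  "complete_like G \<longleftrightarrow> (\<forall>u\<in>set [0..<fst G]. \<forall>v\<in>set [0..<fst G]. u \<noteq> v \<longrightarrow> snd G u v)"

text \<open>An executable weakening of \<open>known_condition\<close> without (i) and (j). The
  families in (b) and (c) both force all edges through one vertex, so they share a line.\<close>

definition maybe_known :: "graph \<Rightarrow> graph \<Rightarrow> bool" where
  "maybe_known H1 H2 \<longleftrightarrow>
     H1 \<sqsubseteq> P 4 \<or> H2 \<sqsubseteq> P 4
   \<or> star_cover (gcompl H1) \<and> star_cover H2
   \<or> complete_like H1 \<and> (two_stars_like H2 \<or> star_plus_like H2 \<or> H2 \<sqsubseteq> P 5)
   \<or> H1 \<sqsubseteq> paw \<and> (H2 \<sqsubseteq> P 2 \<oplus> P 4 \<or> H2 \<sqsubseteq> P 6 \<or> H2 \<sqsubseteq> S_graph 1 2 2 \<or> cover2 H2)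
   \<or> H1 \<sqsubseteq> diamond \<and> H2 \<sqsubseteq> P 1 \<oplus> gcopies 2 (P 2)
   \<or> H1 \<sqsubseteq> gem \<and> (H2 \<sqsubseteq> P 1 \<oplus> P 4 \<or> H2 \<sqsubseteq> P 5)
   \<or> H1 \<sqsubseteq> gcompl (gcopies 2 (P 1) \<oplus> P 3) \<and> (H2 \<sqsubseteq> P 2 \<oplus> P 3 \<or> H2 \<sqsubseteq> P 5)
   \<or> K 3 \<sqsubseteq> H1 \<and> (gcopies 2 (P 1) \<oplus> gcopies 2 (P 2) \<sqsubseteq> H2 \<or> P 1 \<oplus> gcopies 2 (P 3) \<sqsubseteq> H2 \<or>
        gcopies 2 (P 1) \<oplus> P 4 \<sqsubseteq> H2 \<or> gcopies 3 (P 2) \<sqsubseteq> H2)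
   \<or> K 4 \<sqsubseteq> H1 \<and> (star_pplus 4 \<sqsubseteq> H2 \<or> P 1 \<oplus> gcopies 2 (P 2) \<sqsubseteq> H2 \<or> P 1 \<oplus> P 4 \<sqsubseteq> H2)
   \<or> K 5 \<sqsubseteq> H1 \<and> star_pplus 3 \<sqsubseteq> H2
   \<or> cycle_graph 4 \<sqsubseteq> H1 \<and> (star_graph 3 \<sqsubseteq> H2 \<or> gcopies 3 (P 1) \<oplus> P 2 \<sqsubseteq> H2 \<or> gcopies 2 (P 2) \<sqsubseteq> H2)
   \<or> diamond \<sqsubseteq> H1 \<and> (star_graph 3 \<sqsubseteq> H2 \<or> P 2 \<oplus> P 4 \<sqsubseteq> H2 \<or> gcopies 2 (P 3) \<sqsubseteq> H2 \<or> P 6 \<sqsubseteq> H2)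
   \<or> gem \<sqsubseteq> H1 \<and> P 1 \<oplus> gcopies 2 (P 2) \<sqsubseteq> H2"

section \<open>Necessary conditions for the infinite families\<close>

lemma embedding_preimage:
  assumes "inj_on f {..<n::nat}"
  obtains c' where "c' \<in> set [0..<Suc n]" "\<And>u. u < n \<Longrightarrow> f u = c \<longleftrightarrow> u = c'"
proof (cases "c \<in> f ` {..<n}")
  case True
  then obtain c' where "c' < n" "f c' = c" by auto
  then show ?thesis using that[of c'] assms by (auto simp: inj_on_def)
next
  case False then show ?thesis using that[of n] by auto
qed

lemma star_cover_sub:
  assumes "G \<sqsubseteq> H" "\<And>u v. u < fst H \<Longrightarrow> v < fst H \<Longrightarrow> snd H u v \<Longrightarrow> u = c \<or> v = c"
  shows "star_cover G"
proof -
  obtain f where f: "inj_on f {..<fst G}" "f ` {..<fst G} \<subseteq> {..<fst H}"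
    "\<forall>u<fst G. \<forall>v<fst G. snd G u v \<longleftrightarrow> snd H (f u) (f v)"
    using assms(1) unfolding induced_sub_def by blast
  obtain c' where c': "c' \<in> set [0..<Suc (fst G)]" "\<And>u. u < fst G \<Longrightarrow> f u = c \<longleftrightarrow> u = c'"
    using embedding_preimage[OF f(1)] by blast
  have "u = c' \<or> v = c'" if "u < fst G" "v < fst G" "snd G u v" for u v
    using assms(2)[of "f u" "f v"] f(2,3) c'(2)[of u] c'(2)[of v] that by blast
  then show ?thesis unfolding star_cover_def by - (rule bexI[OF _ c'(1)], auto)
qed

lemma cover2_sub:
  assumes "G \<sqsubseteq> H" "\<And>u v. u < fst H \<Longrightarrow> v < fst H \<Longrightarrow> snd H u v \<Longrightarrow> u = c \<or> v = c \<or> u = d \<or> v = d"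
  shows "cover2 G"
proof -
  obtain f where f: "inj_on f {..<fst G}" "f ` {..<fst G} \<subseteq> {..<fst H}"
    "\<forall>u<fst G. \<forall>v<fst G. snd G u v \<longleftrightarrow> snd H (f u) (f v)"
    using assms(1) unfolding induced_sub_def by blast
  obtain c' where c': "c' \<in> set [0..<Suc (fst G)]" "\<And>u. u < fst G \<Longrightarrow> f u = c \<longleftrightarrow> u = c'"
    using embedding_preimage[OF f(1)] by blast
  obtain d' where d': "d' \<in> set [0..<Suc (fst G)]" "\<And>u. u < fst G \<Longrightarrow> f u = d \<longleftrightarrow> u = d'"
    using embedding_preimage[OF f(1)] by blast
  have "u = c' \<or> v = c' \<or> u = d' \<or> v = d'" if "u < fst G" "v < fst G" "snd G u v" for u v
    using assms(2)[of "f u" "f v"] f(2,3) c'(2)[of u] c'(2)[of v] d'(2)[of u] d'(2)[of v] that by blast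
  then show ?thesis unfolding cover2_def 
    by - (rule bexI[OF _ c'(1)], rule bexI[OF _ d'(1)], auto)
qed

lemma two_stars_like_sub:
  assumes "G \<sqsubseteq> H" "\<And>u v. u < fst H \<Longrightarrow> v < fst H \<Longrightarrow> snd H u v \<Longrightarrow> u = c \<or> v = c \<or> u = d \<or> v = d"
    "\<And>v. \<not> (snd H c v \<and> snd H v d)"
  shows "two_stars_like G"
proof -
  obtain f where f: "inj_on f {..<fst G}" "f ` {..<fst G} \<subseteq> {..<fst H}"
    "\<forall>u<fst G. \<forall>v<fst G. snd G u v \<longleftrightarrow> snd H (f u) (f v)"
    using assms(1) unfolding induced_sub_def by blast
  obtain c' where c': "c' \<in> set [0..<Suc (fst G)]" "\<And>u. u < fst G \<Longrightarrow> f u = c \<longleftrightarrow> u = c'"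
    using embedding_preimage[OF f(1)] by blast
  obtain d' where d': "d' \<in> set [0..<Suc (fst G)]" "\<And>u. u < fst G \<Longrightarrow> f u = d \<longleftrightarrow> u = d'"
    using embedding_preimage[OF f(1)] by blast
  have "u = c' \<or> v = c' \<or> u = d' \<or> v = d'" if "u < fst G" "v < fst G" "snd G u v" for u v
    using assms(2)[of "f u" "f v"] f(2,3) c'(2)[of u] c'(2)[of v] d'(2)[of u] d'(2)[of v] that by blast
  moreover have "\<not> (u = c' \<and> w = d' \<and> snd G v w)" if "u < fst G" "v < fst G" "w < fst G" "snd G u v" for u v w
    using assms(3)[of "f v"] f(3) c'(2)[of u] d'(2)[of w] that by blast
  ultimately show ?thesis unfolding two_stars_like_def 
    by - (rule bexI[OF _ c'(1)], rule bexI[OF _ d'(1)], auto)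
qed

lemma star_plus_like_sub:
  assumes "G \<sqsubseteq> H" "\<And>u v. u < fst H \<Longrightarrow> v < fst H \<Longrightarrow> snd H u v \<Longrightarrow>
      u = c \<or> v = c \<or> (u = d \<and> v = e) \<or> (u = e \<and> v = d)"
  shows "star_plus_like G"
proof -
  obtain f where f: "inj_on f {..<fst G}" "f ` {..<fst G} \<subseteq> {..<fst H}"
    "\<forall>u<fst G. \<forall>v<fst G. snd G u v \<longleftrightarrow> snd H (f u) (f v)"
    using assms(1) unfolding induced_sub_def by blast
  obtain c' where c': "c' \<in> set [0..<Suc (fst G)]" "\<And>u. u < fst G \<Longrightarrow> f u = c \<longleftrightarrow> u = c'"
    using embedding_preimage[OF f(1)] by blast
  obtain d' where d': "d' \<in> set [0..<Suc (fst G)]" "\<And>u. u < fst G \<Longrightarrow> f u = d \<longleftrightarrow> u = d'"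
    using embedding_preimage[OF f(1)] by blast
  obtain e' where e': "e' \<in> set [0..<Suc (fst G)]" "\<And>u. u < fst G \<Longrightarrow> f u = e \<longleftrightarrow> u = e'"
    using embedding_preimage[OF f(1)] by blast
  have "u = c' \<or> v = c' \<or> (u = d' \<and> v = e') \<or> (u = e' \<and> v = d')" if "u < fst G" "v < fst G" "snd G u v" for u v
    using assms(2)[of "f u" "f v"] f(2,3) c'(2)[of u] c'(2)[of v] d'(2)[of u] d'(2)[of v] e'(2)[of u] e'(2)[of v] that
    by blast
  then show ?thesis unfolding star_plus_like_def 
    by - (rule bexI[OF _ c'(1)], rule bexI[OF _ d'(1)], rule bexI[OF _ e'(1)], auto)
qed

lemma family_necessary:
  "G \<sqsubseteq> star_graph t \<oplus> P 1 \<Longrightarrow> star_cover G"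
  "G \<sqsubseteq> gcopies t (P 1) \<oplus> P 3 \<Longrightarrow> star_cover G"
  "G \<sqsubseteq> K t \<Longrightarrow> complete_like G"
  "G \<sqsubseteq> gcopies 2 (star_graph t) \<Longrightarrow> two_stars_like G"
  "G \<sqsubseteq> star_plus t \<Longrightarrow> star_plus_like G"
  "G \<sqsubseteq> star_pplus t \<oplus> P 1 \<Longrightarrow> cover2 G"
proof -
  show "star_cover G" if "G \<sqsubseteq> star_graph t \<oplus> P 1"
    by (rule star_cover_sub[OF that, of 0]) (auto simp: gunion_def star_graph_def path_graph_def)
  show "star_cover G" if "G \<sqsubseteq> gcopies t (P 1) \<oplus> P 3"
  \<comment> \<open>The path follows the \<open>t\<close> isolated vertices and occupies
    \<open>t\<close>, \<open>t + 1\<close>, \<open>t + 2\<close>; \<open>Suc t\<close> is its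
    middle.\<close>
  proof (rule star_cover_sub[OF that, of "Suc t"])
    define Q where "Q = gcopies t (P 1)"
    have Q: "fst Q = t" "u < t \<Longrightarrow> v < t \<Longrightarrow> \<not> snd Q u v" for u v
      using gcopies_P1 unfolding Q_def by blast+
    fix u v assume "u < fst (gcopies t (P 1) \<oplus> P 3)" "v < fst (gcopies t (P 1) \<oplus> P 3)"
      "snd (gcopies t (P 1) \<oplus> P 3) u v"
    then have "t \<le> u \<and> t \<le> v \<and> (u - t + 1 = v - t \<or> v - t + 1 = u - t)" "u < t + 3" "v < t + 3"
      using Q(2)[of u v] unfolding Q_def[symmetric] gunion_def Q(1) by (auto simp: path_graph_def)
    then show "u = Suc t \<or> v = Suc t" by linarith
  qed
  show "complete_like G" if K: "G \<sqsubseteq> K t"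
  proof -
    obtain f where f: "inj_on f {..<fst G}"
      "\<forall>u<fst G. \<forall>v<fst G. snd G u v \<longleftrightarrow> snd (K t) (f u) (f v)"
      using K unfolding induced_sub_def by blast
    have "snd G u v" if "u < fst G" "v < fst G" "u \<noteq> v" for u v
      using f(2) that inj_on_eq_iff[OF f(1), of u v] by (simp add: complete_graph_def)
    then show ?thesis unfolding complete_like_def by simp
  qed
  show "two_stars_like G" if "G \<sqsubseteq> gcopies 2 (star_graph t)"
    by (rule two_stars_like_sub[OF that, of 0 "Suc t"])
      (auto simp: numeral_2_eq_2 gunion_def star_graph_def null_graph_def)
  have leg: "snd (spider (l # replicate m 1)) u v \<Longrightarrow> u = 0 \<or> v = 0 \<or> m < u \<and> m < v \<and> (u + 1 = v \<and> v \<le> m + l \<or> v + 1 = u \<and> u \<le> m + l)" for l m u v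
    by (auto simp: spider_Cons_adj spider_star_adj leg_edge_def fst_spider sum_list_replicate)
  show "star_plus_like G" if "G \<sqsubseteq> star_plus t"
  \<comment> \<open>The \<open>t - 1\<close> short legs are attached before the long one, whose two
    vertices get these numbers; they span the only edge that avoids the centre.\<close>
  proof (rule star_plus_like_sub[OF that, of 0 "Suc (t - 1)" "Suc (Suc (t - 1))"])
    fix u v assume "snd (star_plus t) u v"
    from leg[OF this[unfolded star_plus_def]]
    show "u = 0 \<or> v = 0 \<or> u = Suc (t - 1) \<and> v = Suc (Suc (t - 1)) \<or> u = Suc (Suc (t - 1)) \<and> v = Suc (t - 1)"
      by linarith
  qed
  show "cover2 G" if "G \<sqsubseteq> star_pplus t \<oplus> P 1"
  \<comment> \<open>The cover consists of the centre and the middle vertex of the leg of length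
    3.\<close>
  proof (rule cover2_sub[OF that, of 0 "Suc (Suc (t - 1))"])
    fix u v assume *: "u < fst (star_pplus t \<oplus> P 1)" "v < fst (star_pplus t \<oplus> P 1)" "snd (star_pplus t \<oplus> P 1) u v"
    then have "snd (spider (3 # replicate (t - 1) 1)) u v" by (auto simp: gunion_def path_graph_def star_pplus_def)
    from leg[OF this] show "u = 0 \<or> v = 0 \<or> u = Suc (Suc (t - 1)) \<or> v = Suc (Suc (t - 1))" by linarith
  qed
qed

lemma known_imp_maybe_known:
  assumes "known_condition H1 H2"
  shows "maybe_known H1 H2 \<or> (\<not> path_star_forest H1 \<and> \<not> path_star_forest H2)
    \<or> (\<not> path_star_forest (gcompl H1) \<and> \<not> path_star_forest (gcompl H2))"
proof -
  have b: "(\<exists>t\<ge>1. gcompl H1 \<sqsubseteq> star_graph t \<oplus> P 1 \<and> H2 \<sqsubseteq> star_graph t \<oplus> P 1) \<Longrightarrow> star_cover (gcompl H1) \<and> star_cover H2"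
    using family_necessary(1) by blast
  have c: "(\<exists>t\<ge>1. gcompl H1 \<sqsubseteq> gcopies t (P 1) \<oplus> P 3 \<and> H2 \<sqsubseteq> gcopies t (P 1) \<oplus> P 3) \<Longrightarrow> star_cover (gcompl H1) \<and> star_cover H2"
    using family_necessary(2) by blast
  have d: "(\<exists>t\<ge>1. H1 \<sqsubseteq> K t \<and> (H2 \<sqsubseteq> gcopies 2 (star_graph t) \<or> H2 \<sqsubseteq> star_plus t \<or> H2 \<sqsubseteq> P 5)) \<Longrightarrow>
      complete_like H1 \<and> (two_stars_like H2 \<or> star_plus_like H2 \<or> H2 \<sqsubseteq> P 5)"
    using family_necessary(3,4,5) by blast
  have e: "(\<exists>t\<ge>1. H2 \<sqsubseteq> star_pplus t \<oplus> P 1) \<Longrightarrow> cover2 H2" using family_necessary(6) by blast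
  show ?thesis using assms b c d e unfolding known_condition_def maybe_known_def by argo
qed

section \<open>Isomorphism invariance, base pairs and their orbits\<close>

lemma path_star_forest_iso: "graph_iso F G \<Longrightarrow> path_star_forest G \<Longrightarrow> path_star_forest F"
  unfolding path_star_forest_def using graph_iso_trans by blast

lemma known_condition_iso:
  assumes "graph_iso X X'" "graph_iso Y Y'" "known_condition X Y"
  shows "known_condition X' Y'"
proof -
  have sub1: "G \<sqsubseteq> F \<longleftrightarrow> G' \<sqsubseteq> F" if "graph_iso G G'" for F G G'
    using iso_transfer(3)[OF that] iso_transfer(3)[OF graph_iso_sym[OF that]] by blast
  have sub2: "F \<sqsubseteq> G \<longleftrightarrow> F \<sqsubseteq> G'" if "graph_iso G G'" for F G G'
    using iso_transfer(2)[OF that] iso_transfer(2)[OF graph_iso_sym[OF that]] by blast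
  have psf: "path_star_forest G \<longleftrightarrow> path_star_forest G'" if "graph_iso G G'" for G G'
    using path_star_forest_iso[OF that] path_star_forest_iso[OF graph_iso_sym[OF that]] by blast
  note iso = assms(1,2) assms(1)[THEN gcompl_iso] assms(2)[THEN gcompl_iso]
  show ?thesis using assms(3) unfolding known_condition_def iso[THEN sub1] iso[THEN sub2] iso[THEN psf] .
qed

text \<open>The six classes in the coordinates \<open>(gcompl A, B)\<close>. The two pairs with a
  triangle also occur with the paw, the complement of P_1+P_3, so that the list is closed under that
  exchange.\<close>

definition base_pair :: "graph \<Rightarrow> graph \<Rightarrow> bool" where
  "base_pair A B \<longleftrightarrow>
     (A = gcopies 3 (P 1) \<or> A = P 1 \<oplus> P 3) \<and> (B = P 7 \<or> B = S_graph 1 2 3)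
   \<or> A = gcopies 4 (P 1) \<and> B = S_graph 1 1 3
   \<or> A = gcopies 2 (P 1) \<oplus> P 2 \<and> (B = P 1 \<oplus> P 2 \<oplus> P 3 \<or> B = P 1 \<oplus> P 5)
   \<or> A = P 1 \<oplus> P 4 \<and> B = P 2 \<oplus> P 3"

lemma base_pair_cases [consumes 1, case_names 1 2 3 4 5 6 7 8]:
  assumes "base_pair A B"
  obtains "A = gcopies 3 (P 1)" "B = P 7" | "A = gcopies 3 (P 1)" "B = S_graph 1 2 3"
  | "A = P 1 \<oplus> P 3" "B = P 7" | "A = P 1 \<oplus> P 3" "B = S_graph 1 2 3"
  | "A = gcopies 4 (P 1)" "B = S_graph 1 1 3" | "A = gcopies 2 (P 1) \<oplus> P 2" "B = P 1 \<oplus> P 2 \<oplus> P 3"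
  | "A = gcopies 2 (P 1) \<oplus> P 2" "B = P 1 \<oplus> P 5" | "A = P 1 \<oplus> P 4" "B = P 2 \<oplus> P 3"
  using assms unfolding base_pair_def by blast

text \<open>Both orders are tested, before and after complementing, because
  \<open>known_condition\<close> is ordered. The last six clauses ensure that a triangle or paw can
  occur only as \<open>gcompl A\<close>, so an exchange leads to another base pair.\<close>

definition never_known :: "graph \<Rightarrow> graph \<Rightarrow> bool" where
  "never_known A B \<longleftrightarrow>
     \<not> maybe_known (gcompl A) B \<and> \<not> maybe_known B (gcompl A) \<and>
     \<not> maybe_known A (gcompl B) \<and> \<not> maybe_known (gcompl B) A \<and>
     \<not> graph_iso (K 3) A \<and> \<not> graph_iso (K 3) B \<and> \<not> graph_iso (K 3) (gcompl B) \<and>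
     \<not> graph_iso paw A \<and> \<not> graph_iso paw B \<and> \<not> graph_iso paw (gcompl B)"

lemma never_known_1: "never_known (gcopies 3 (P 1)) (P 7)"
  by code_simp

lemma never_known_2: "never_known (gcopies 3 (P 1)) (S_graph 1 2 3)"
  by code_simp

lemma never_known_3: "never_known (P 1 \<oplus> P 3) (P 7)"
  by code_simp

lemma never_known_4: "never_known (P 1 \<oplus> P 3) (S_graph 1 2 3)"
  by code_simp

lemma never_known_5: "never_known (gcopies 4 (P 1)) (S_graph 1 1 3)"
  by code_simp

lemma never_known_6: "never_known (gcopies 2 (P 1) \<oplus> P 2) (P 1 \<oplus> P 2 \<oplus> P 3)"
  by code_simp

lemma never_known_7: "never_known (gcopies 2 (P 1) \<oplus> P 2) (P 1 \<oplus> P 5)"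
  by code_simp

lemma never_known_8: "never_known (P 1 \<oplus> P 4) (P 2 \<oplus> P 3)"
  by code_simp

lemma base_pair_never_known: "base_pair A B \<Longrightarrow> never_known A B"
  using never_known_1 never_known_2 never_known_3 never_known_4 never_known_5 never_known_6 never_known_7 never_known_8
  unfolding base_pair_def by blast

lemma wf_gunion: "wf_graph A \<Longrightarrow> wf_graph B \<Longrightarrow> wf_graph (A \<oplus> B)"
  by (auto simp: wf_graph_def gunion_def)

lemma wf_path_graph: "wf_graph (P r)"
  by (auto simp: wf_graph_def path_graph_def)

lemma wf_gcopies: "wf_graph A \<Longrightarrow> wf_graph (gcopies t A)"
  by (induction t) (simp add: wf_graph_def null_graph_def, simp add: wf_gunion)

lemma spider_sym: "snd (spider ls) u v \<longleftrightarrow> snd (spider ls) v u"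
  by (induction ls) (auto simp: spider_Cons_adj)

lemma wf_S_graph: "wf_graph (S_graph h i j)"
  unfolding wf_graph_def S_graph_def using spider_sym spider_irrefl by blast

lemma base_pair_wf: "base_pair A B \<Longrightarrow> wf_graph A \<and> wf_graph B"
  by (erule base_pair_cases) (simp_all only: wf_gunion wf_path_graph wf_gcopies wf_S_graph simp_thms)

lemma path_star_forestI: "graph_iso G (forest lss) \<Longrightarrow> \<forall>ls\<in>set lss. \<forall>l\<in>set ls. 0 < l \<Longrightarrow> path_star_forest G"
  unfolding path_star_forest_def forest_def by blast

lemma base_pair_psf:
  assumes "base_pair A B" shows "path_star_forest A" "path_star_forest B"
proof -
  have A: "graph_iso (gcopies 3 (P 1)) (forest [[], [], []])" "graph_iso (P 1 \<oplus> P 3) (forest [[], [2]])"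
    "graph_iso (gcopies 4 (P 1)) (forest [[], [], [], []])" "graph_iso (gcopies 2 (P 1) \<oplus> P 2) (forest [[], [], [1]])"
    "graph_iso (P 1 \<oplus> P 4) (forest [[], [3]])"
    by code_simp+
  show "path_star_forest A"
    by (rule base_pair_cases[OF assms]; hypsubst+; rule path_star_forestI, rule A, simp)
  have B: "graph_iso (P 7) (forest [[6]])" "graph_iso (S_graph 1 2 3) (forest [[1, 2, 3]])"
    "graph_iso (S_graph 1 1 3) (forest [[1, 1, 3]])" "graph_iso (P 1 \<oplus> P 2 \<oplus> P 3) (forest [[], [1], [2]])"
    "graph_iso (P 1 \<oplus> P 5) (forest [[], [4]])" "graph_iso (P 2 \<oplus> P 3) (forest [[1], [2]])"
    by code_simp+
  show "path_star_forest B"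
    by (rule base_pair_cases[OF assms]; hypsubst+; rule path_star_forestI, rule B, simp)
qed

fun orbit :: "graph \<times> graph \<Rightarrow> bool" where
  "orbit (X, Y) \<longleftrightarrow> (\<exists>A B. base_pair A B \<and>
     (graph_iso X (gcompl A) \<and> graph_iso Y B \<or> graph_iso X B \<and> graph_iso Y (gcompl A) \<or>
      graph_iso X A \<and> graph_iso Y (gcompl B) \<or> graph_iso X (gcompl B) \<and> graph_iso Y A))"

text \<open>In each of the four arrangements one graph is a path star forest and one graph has such
  a complement, so (i) and (j) fail. Every other condition would imply \<open>maybe_known\<close>,
  which evaluation has refuted for all base pairs.\<close>

lemma orbit_not_known:
  assumes "orbit (X, Y)" shows "\<not> known_condition X Y"
proof
  assume known: "known_condition X Y"
  obtain A B where b: "base_pair A B" and AB: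
     "graph_iso X (gcompl A) \<and> graph_iso Y B \<or> graph_iso X B \<and> graph_iso Y (gcompl A) \<or>
      graph_iso X A \<and> graph_iso Y (gcompl B) \<or> graph_iso X (gcompl B) \<and> graph_iso Y A"
    using assms by auto
  have cc: "path_star_forest (gcompl (gcompl A))" "path_star_forest (gcompl (gcompl B))"
    using base_pair_psf[OF b] base_pair_wf[OF b] gcompl_gcompl path_star_forest_iso by blast+
  have "known_condition (gcompl A) B \<or> known_condition B (gcompl A) \<or> known_condition A (gcompl B) \<or> known_condition (gcompl B) A"
    using AB known known_condition_iso by blast
  then show False
    using known_imp_maybe_known base_pair_never_known[OF b, unfolded never_known_def] base_pair_psf[OF b] cc by blast
qed

lemma base_pair_K3:
  assumes "base_pair A B"
  shows "\<not> graph_iso (K 3) A" "\<not> graph_iso (K 3) B" "\<not> graph_iso (K 3) (gcompl B)"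
    "graph_iso (K 3) (gcompl A) \<Longrightarrow> base_pair (P 1 \<oplus> P 3) B"
proof -
  show "\<not> graph_iso (K 3) A" "\<not> graph_iso (K 3) B" "\<not> graph_iso (K 3) (gcompl B)"
    using base_pair_never_known[OF assms] unfolding never_known_def by blast+
  have no: "\<not> graph_iso (K 3) (gcompl (gcopies 4 (P 1)))" "\<not> graph_iso (K 3) (gcompl (gcopies 2 (P 1) \<oplus> P 2))"
    "\<not> graph_iso (K 3) (gcompl (P 1 \<oplus> P 4))" by code_simp+
  show "base_pair (P 1 \<oplus> P 3) B" if "graph_iso (K 3) (gcompl A)"
    by (rule base_pair_cases[OF assms]; use no that in \<open>simp only: base_pair_def simp_thms\<close>)
qed

lemma base_pair_paw:
  assumes "base_pair A B"
  shows "\<not> graph_iso paw A" "\<not> graph_iso paw B" "\<not> graph_iso paw (gcompl B)"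
    "graph_iso paw (gcompl A) \<Longrightarrow> base_pair (gcopies 3 (P 1)) B"
proof -
  show "\<not> graph_iso paw A" "\<not> graph_iso paw B" "\<not> graph_iso paw (gcompl B)"
    using base_pair_never_known[OF assms] unfolding never_known_def by blast+
  have no: "\<not> graph_iso paw (gcompl (gcopies 4 (P 1)))" "\<not> graph_iso paw (gcompl (gcopies 2 (P 1) \<oplus> P 2))"
    "\<not> graph_iso paw (gcompl (P 1 \<oplus> P 4))" by code_simp+
  show "base_pair (gcopies 3 (P 1)) B" if "graph_iso paw (gcompl A)"
    by (rule base_pair_cases[OF assms]; use no that in \<open>simp only: base_pair_def simp_thms\<close>)
qed

lemma orbit_step:
  assumes "equiv_step p q" "orbit p" shows "orbit q"
  using assms(1)
proof cases
  case (swap A B) then show ?thesis using assms(2) unfolding swap orbit.simps by blast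
next
  case (compl X Y)
  obtain A B where b: "base_pair A B" and AB:
     "graph_iso X (gcompl A) \<and> graph_iso Y B \<or> graph_iso X B \<and> graph_iso Y (gcompl A) \<or>
      graph_iso X A \<and> graph_iso Y (gcompl B) \<or> graph_iso X (gcompl B) \<and> graph_iso Y A"
    using assms(2) unfolding compl(1) orbit.simps by blast
  have "graph_iso Z (gcompl A) \<Longrightarrow> graph_iso (gcompl Z) A" "graph_iso Z (gcompl B) \<Longrightarrow> graph_iso (gcompl Z) B" for Z
    using gcompl_iso gcompl_gcompl base_pair_wf[OF b] graph_iso_trans by blast+
  then have "graph_iso (gcompl X) A \<and> graph_iso (gcompl Y) (gcompl B) \<or> graph_iso (gcompl X) (gcompl B) \<and> graph_iso (gcompl Y) A \<or>
      graph_iso (gcompl X) (gcompl A) \<and> graph_iso (gcompl Y) B \<or> graph_iso (gcompl X) B \<and> graph_iso (gcompl Y) (gcompl A)"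
    using AB gcompl_iso by blast
  then show ?thesis unfolding compl orbit.simps using b by blast
next
  case (iso X X' Y Y')
  have "graph_iso X Z \<Longrightarrow> graph_iso X' Z" "graph_iso Y Z \<Longrightarrow> graph_iso Y' Z" for Z
    using graph_iso_trans[OF graph_iso_sym] iso(3,4) by blast+
  then show ?thesis using assms(2) unfolding iso(1,2) orbit.simps by blast
next
  case (k3_paw X X' Y)
  obtain A B where b: "base_pair A B" and AB:
     "graph_iso X (gcompl A) \<and> graph_iso Y B \<or> graph_iso X B \<and> graph_iso Y (gcompl A) \<or>
      graph_iso X A \<and> graph_iso Y (gcompl B) \<or> graph_iso X (gcompl B) \<and> graph_iso Y A"
    using assms(2) unfolding k3_paw(1) orbit.simps by blast
  have "graph_iso X Z \<Longrightarrow> graph_iso (K 3) Z" for Z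
    using graph_iso_trans[OF graph_iso_sym[OF k3_paw(3)]] .
  \<comment> \<open>Of the four arrangements only the one with \<open>X\<close> isomorphic to
    \<open>gcompl A\<close> survives, since the others would make a triangle of \<open>B\<close>,
    \<open>A\<close> or \<open>gcompl B\<close>.\<close>
  then have "graph_iso Y B" "base_pair (P 1 \<oplus> P 3) B" using AB base_pair_K3[OF b] by blast+
  then show ?thesis using k3_paw(4) unfolding k3_paw(2) paw_def orbit.simps by blast
next
  case (paw_k3 X X' Y)
  obtain A B where b: "base_pair A B" and AB:
     "graph_iso X (gcompl A) \<and> graph_iso Y B \<or> graph_iso X B \<and> graph_iso Y (gcompl A) \<or>
      graph_iso X A \<and> graph_iso Y (gcompl B) \<or> graph_iso X (gcompl B) \<and> graph_iso Y A"
    using assms(2) unfolding paw_k3(1) orbit.simps by blast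
  have "graph_iso X Z \<Longrightarrow> graph_iso paw Z" for Z
    using graph_iso_trans[OF graph_iso_sym[OF paw_k3(3)]] .
  then have "graph_iso Y B" "base_pair (gcopies 3 (P 1)) B" using AB base_pair_paw[OF b] by blast+
  moreover have "graph_iso X' (gcompl (gcopies 3 (P 1)))"
    using graph_iso_trans[OF paw_k3(4) graph_iso_sym[OF gcompl_gcopies_P1]] .
  ultimately show ?thesis unfolding paw_k3(2) orbit.simps by blast
qed

lemma orbit_pair_equiv: "pair_equiv p q \<Longrightarrow> orbit p \<Longrightarrow> orbit q"
  unfolding pair_equiv_def by (induction rule: rtranclp_induct) (auto intro: orbit_step)

lemma orbit_six:
  "orbit (K 3, P 7)" "orbit (K 3, S_graph 1 2 3)" "orbit (K 4, S_graph 1 1 3)"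
  "orbit (diamond, P 1 \<oplus> P 2 \<oplus> P 3)" "orbit (diamond, P 1 \<oplus> P 5)" "orbit (gem, P 2 \<oplus> P 3)"
proof -
  have orbit: "orbit (X, B)" if "base_pair A B" "graph_iso X (gcompl A)" for X A B
    using that graph_iso_refl by (simp only: orbit.simps) blast
  have K: "graph_iso (K t) (gcompl (gcopies t (P 1)))" for t using graph_iso_sym[OF gcompl_gcopies_P1] .
  show "orbit (K 3, P 7)" "orbit (K 3, S_graph 1 2 3)"
    by (rule orbit[OF _ K], simp only: base_pair_def simp_thms)+
  show "orbit (K 4, S_graph 1 1 3)" by (rule orbit[OF _ K]) (simp only: base_pair_def simp_thms)
  show "orbit (diamond, P 1 \<oplus> P 2 \<oplus> P 3)" "orbit (diamond, P 1 \<oplus> P 5)"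
    unfolding diamond_def by (rule orbit[OF _ graph_iso_refl], simp only: base_pair_def simp_thms)+
  show "orbit (gem, P 2 \<oplus> P 3)"
    unfolding gem_def by (rule orbit[OF _ graph_iso_refl]) (simp only: base_pair_def simp_thms)
qed

text \<open>The equivalence is followed back from one of the six pairs to \<open>(H1, H2)\<close>
  and on to a supposedly resolved pair. That pair then lies in \<open>orbit\<close>, where no
  condition holds.\<close>

theorem six_classes_imp_unknown:
  assumes wf: "wf_graph H1" "wf_graph H2" and six: "six_classes (H1, H2)"
  shows "\<not> reaches_known (H1, H2)"
proof
  assume "reaches_known (H1, H2)"
  then obtain H3 H4 where H: "pair_equiv (H1, H2) (H3, H4)" "known_condition H3 H4"
    unfolding reaches_known_def by blast
  obtain q where q: "pair_equiv (H1, H2) q" "orbit q" using six orbit_six unfolding six_classes_def by blast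
  have "pair_equiv q (H1, H2)" using pair_equiv_sym[OF q(1)] wf by simp
  then have "orbit (H1, H2)" using q(2) orbit_pair_equiv by blast
  then have "orbit (H3, H4)" using H(1) orbit_pair_equiv by blast
  then show False using orbit_not_known H(2) by blast
qed

theorem theorem11:
  assumes "wf_graph H1" and "wf_graph H2"
  shows "(\<not> (\<exists>H3 H4. wf_graph H3 \<and> wf_graph H4 \<and> pair_equiv (H1, H2) (H3, H4) \<and> known_condition H3 H4))
     \<longleftrightarrow> (pair_equiv (H1, H2) (K 3, P 7)
        \<or> pair_equiv (H1, H2) (K 3, S_graph 1 2 3)
        \<or> pair_equiv (H1, H2) (K 4, S_graph 1 1 3)
        \<or> pair_equiv (H1, H2) (diamond, P 1 \<oplus> P 2 \<oplus> P 3)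
        \<or> pair_equiv (H1, H2) (diamond, P 1 \<oplus> P 5)
        \<or> pair_equiv (H1, H2) (gem, P 2 \<oplus> P 3))"
  using unknown_imp_six_classes[OF assms] six_classes_imp_unknown[OF assms]
  unfolding reaches_known_def six_classes_def by blast

end
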